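(* Let $(A,\cdot_1,\circ)$ be a transposed Novikov-Poisson algebra and $(B,\cdot_2,\diamond)$ a right differential Novikov-Poisson algebra, both over $\mathbf{k}$. Define two binary operations $\cdot$ and $[\cdot,\cdot]$ on $A\otimes B$ by $$(x\otimes a)\cdot(y\otimes b)=(x\cdot_1 y)\otimes(a\cdot_2 b),\qquad [x\otimes a,y\otimes b]=(x\circ y)\otimes(a\diamond b)-(y\circ x)\otimes(b\diamond a)$$ for all $x,y\in A$ and $a,b\in B$ (extended bilinearly). Then $(A\otimes B,\cdot,[\cdot,\cdot])$ is a transposed Poisson algebra.
   Context: $\mathbf{k}$ is a field of characteristic not equal to $2$; tensor products are over $\mathbf{k}$ and all binary operations are $\mathbf{k}$-bilinear. A (left) Novikov algebra $(A,\circ)$ is a vector space with a binary operation satisfying $(x\circ y)\circ z=(x\circ z)\circ y$ and $(x\circ y)\circ z-x\circ(y\circ z)=(y\circ x)\circ z-y\circ(x\circ z)$ for all $x,y,z$. A right Novikov algebra is a vector space $B$ with a binary operation $\diamond$ such that the opposite operation $a\circ b:=b\diamond a$ makes $B$ a (left) Novikov algebra. A transposed Novikov-Poisson algebra is a triple $(A,\cdot,\circ)$ where $(A,\cdot)$ is a commutative associative algebra (not necessarily unital), $(A,\circ)$ is a Novikov algebra, and for all $x,y,z\in A$: $(x\cdot y)\circ z=(x\cdot z)\circ y$ and $2z\cdot(x\circ y)=(z\cdot x)\circ y+x\circ(z\cdot y)$. A right differential Novikov-Poisson algebra is a triple $(B,\cdot,\diamond)$ where $(B,\cdot)$ is a commutative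 associative algebra, $(B,\diamond)$ is a right Novikov algebra, and for all $a,b,c\in B$: $(a\diamond b)\cdot c=a\diamond(b\cdot c)$ and $(a\cdot b)\diamond c=(a\diamond c)\cdot b+a\cdot(b\diamond c)$. A transposed Poisson algebra is a triple $(L,\cdot,[\cdot,\cdot])$ where $(L,\cdot)$ is a commutative associative algebra, $(L,[\cdot,\cdot])$ is a Lie algebra, and $2z\cdot[x,y]=[z\cdot x,y]+[x,z\cdot y]$ for all $x,y,z\in L$. *)

theory Defs
  imports "HOL-Algebra.Module" "HOL-Algebra.AbelCoset"
begin

section \<open>Tensor product of modules\<close>

definition bilinear_map ::
  "('k, 'r) ring_scheme \<Rightarrow> ('k, 'u, 's) module_scheme \<Rightarrow> ('k, 'v, 't) module_scheme \<Rightarrow>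
   ('k, 'w, 'q) module_scheme \<Rightarrow> ('u \<Rightarrow> 'v \<Rightarrow> 'w) \<Rightarrow> bool"
  where "bilinear_map K U V W f \<longleftrightarrow>
    (\<forall>u\<in>carrier U. \<forall>v\<in>carrier V. f u v \<in> carrier W) \<and>
    (\<forall>u\<in>carrier U. \<forall>u'\<in>carrier U. \<forall>v\<in>carrier V. f (u \<oplus>\<^bsub>U\<^esub> u') v = f u v \<oplus>\<^bsub>W\<^esub> f u' v) \<and>
    (\<forall>u\<in>carrier U. \<forall>v\<in>carrier V. \<forall>v'\<in>carrier V. f u (v \<oplus>\<^bsub>V\<^esub> v') = f u v \<oplus>\<^bsub>W\<^esub> f u v') \<and>
    (\<forall>c\<in>carrier K. \<forall>u\<in>carrier U. \<forall>v\<in>carrier V. f (c \<odot>\<^bsub>U\<^esub> u) v = c \<odot>\<^bsub>W\<^esub> f u v) \<and>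
    (\<forall>c\<in>carrier K. \<forall>u\<in>carrier U. \<forall>v\<in>carrier V. f u (c \<odot>\<^bsub>V\<^esub> v) = c \<odot>\<^bsub>W\<^esub> f u v)"

text \<open>
  The record type of modules extends that of rings; its fields \<open>mult\<close> and \<open>one\<close> play no role
  for a module and are left undefined in the two constructions below.
\<close>

definition free_module :: "('k, 'r) ring_scheme \<Rightarrow> 'i set \<Rightarrow> ('k, 'i \<Rightarrow> 'k) module"
  where "free_module K I =
    \<lparr>carrier = {f. range f \<subseteq> carrier K \<and> finite {i. f i \<noteq> \<zero>\<^bsub>K\<^esub>} \<and> {i. f i \<noteq> \<zero>\<^bsub>K\<^esub>} \<subseteq> I},
     mult = undefined, one = undefined,
     zero = (\<lambda>i. \<zero>\<^bsub>K\<^esub>), add = (\<lambda>f g i. f i \<oplus>\<^bsub>K\<^esub> g i),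
     smult = (\<lambda>c f i. c \<otimes>\<^bsub>K\<^esub> f i)\<rparr>"

definition free_gen :: "('k, 'r) ring_scheme \<Rightarrow> 'i \<Rightarrow> 'i \<Rightarrow> 'k"
  where "free_gen K i = (\<lambda>j. if j = i then \<one>\<^bsub>K\<^esub> else \<zero>\<^bsub>K\<^esub>)"

definition submodule_generated ::
  "('k, 'r) ring_scheme \<Rightarrow> ('k, 'v, 's) module_scheme \<Rightarrow> 'v set \<Rightarrow> 'v set"
  where "submodule_generated K V S = \<Inter>{H. submodule H K V \<and> S \<subseteq> H}"

text \<open>The scalar action follows the pattern of \<open>rcoset_mult\<close> for quotient rings.\<close>

definition quotient_module ::
  "('k, 'v, 's) module_scheme \<Rightarrow> 'v set \<Rightarrow> ('k, 'v set) module"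
  where "quotient_module V N =
    \<lparr>carrier = a_rcosets\<^bsub>V\<^esub> N, mult = undefined, one = undefined,
     zero = N, add = (<+>\<^bsub>V\<^esub>),
     smult = (\<lambda>c X. \<Union>v\<in>X. N +>\<^bsub>V\<^esub> (c \<odot>\<^bsub>V\<^esub> v))\<rparr>"

definition tensor_relations ::
  "('k, 'r) ring_scheme \<Rightarrow> ('k, 'a, 's) module_scheme \<Rightarrow> ('k, 'b, 't) module_scheme \<Rightarrow>
   ('a \<times> 'b \<Rightarrow> 'k) set"
  where "tensor_relations K A B =
    (let F = free_module K (carrier A \<times> carrier B); e = (\<lambda>x a. free_gen K (x, a)) in
      {e (x \<oplus>\<^bsub>A\<^esub> y) a \<ominus>\<^bsub>F\<^esub> (e x a \<oplus>\<^bsub>F\<^esub> e y a) | x y a.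
          x \<in> carrier A \<and> y \<in> carrier A \<and> a \<in> carrier B} \<union>
      {e x (a \<oplus>\<^bsub>B\<^esub> b) \<ominus>\<^bsub>F\<^esub> (e x a \<oplus>\<^bsub>F\<^esub> e x b) | x a b.
          x \<in> carrier A \<and> a \<in> carrier B \<and> b \<in> carrier B} \<union>
      {e (c \<odot>\<^bsub>A\<^esub> x) a \<ominus>\<^bsub>F\<^esub> (c \<odot>\<^bsub>F\<^esub> e x a) | c x a.
          c \<in> carrier K \<and> x \<in> carrier A \<and> a \<in> carrier B} \<union>
      {e x (c \<odot>\<^bsub>B\<^esub> a) \<ominus>\<^bsub>F\<^esub> (c \<odot>\<^bsub>F\<^esub> e x a) | c x a.
          c \<in> carrier K \<and> x \<in> carrier A \<and> a \<in> carrier B})"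

definition tensor_kernel ::
  "('k, 'r) ring_scheme \<Rightarrow> ('k, 'a, 's) module_scheme \<Rightarrow> ('k, 'b, 't) module_scheme \<Rightarrow>
   ('a \<times> 'b \<Rightarrow> 'k) set"
  where "tensor_kernel K A B =
    submodule_generated K (free_module K (carrier A \<times> carrier B)) (tensor_relations K A B)"

definition tensor_product ::
  "('k, 'r) ring_scheme \<Rightarrow> ('k, 'a, 's) module_scheme \<Rightarrow> ('k, 'b, 't) module_scheme \<Rightarrow>
   ('k, ('a \<times> 'b \<Rightarrow> 'k) set) module"
  where "tensor_product K A B =
    quotient_module (free_module K (carrier A \<times> carrier B)) (tensor_kernel K A B)"

definition pure_tensor ::
  "('k, 'r) ring_scheme \<Rightarrow> ('k, 'a, 's) module_scheme \<Rightarrow> ('k, 'b, 't) module_scheme \<Rightarrow>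
   'a \<Rightarrow> 'b \<Rightarrow> ('a \<times> 'b \<Rightarrow> 'k) set"
  where "pure_tensor K A B x a =
    tensor_kernel K A B +>\<^bsub>free_module K (carrier A \<times> carrier B)\<^esub> free_gen K (x, a)"

section \<open>Algebras with one or two bilinear operations\<close>

text \<open>
  Every operation is passed as a separate argument; the ring multiplication of the module
  record is never used for them.
\<close>

locale bilinear_algebra = K?: field K + A?: module K A
  for K (structure) and A (structure) +
  fixes prod :: "'c \<Rightarrow> 'c \<Rightarrow> 'c"
  assumes bilinear: "bilinear_map K A A A prod"

locale comm_assoc_algebra = bilinear_algebra K A dot
  for K (structure) and A (structure) and dot (infixl \<open>\<cdot>\<close> 70) +
  assumes commutative: "\<lbrakk>x \<in> carrier A; y \<in> carrier A\<rbrakk> \<Longrightarrow> x \<cdot> y = y \<cdot> x"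
    and associative: "\<lbrakk>x \<in> carrier A; y \<in> carrier A; z \<in> carrier A\<rbrakk> \<Longrightarrow> (x \<cdot> y) \<cdot> z = x \<cdot> (y \<cdot> z)"

locale lie_algebra = bilinear_algebra K L bracket
  for K (structure) and L (structure) and bracket (\<open>\<lbrakk>_,/ _\<rbrakk>\<close>) +
  assumes alternating: "x \<in> carrier L \<Longrightarrow> \<lbrakk>x, x\<rbrakk> = \<zero>\<^bsub>L\<^esub>"
    and jacobi: "x \<in> carrier L \<Longrightarrow> y \<in> carrier L \<Longrightarrow> z \<in> carrier L \<Longrightarrow>
      \<lbrakk>x, \<lbrakk>y, z\<rbrakk>\<rbrakk> \<oplus>\<^bsub>L\<^esub> \<lbrakk>y, \<lbrakk>z, x\<rbrakk>\<rbrakk> \<oplus>\<^bsub>L\<^esub> \<lbrakk>z, \<lbrakk>x, y\<rbrakk>\<rbrakk> = \<zero>\<^bsub>L\<^esub>"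

locale novikov_algebra = bilinear_algebra K A circ
  for K (structure) and A (structure) and circ (infixl \<open>\<circ>\<^sub>N\<close> 70) +
  assumes right_commutative: "\<lbrakk>x \<in> carrier A; y \<in> carrier A; z \<in> carrier A\<rbrakk> \<Longrightarrow>
      (x \<circ>\<^sub>N y) \<circ>\<^sub>N z = (x \<circ>\<^sub>N z) \<circ>\<^sub>N y"
    and left_symmetric: "\<lbrakk>x \<in> carrier A; y \<in> carrier A; z \<in> carrier A\<rbrakk> \<Longrightarrow>
      (x \<circ>\<^sub>N y) \<circ>\<^sub>N z \<ominus>\<^bsub>A\<^esub> x \<circ>\<^sub>N (y \<circ>\<^sub>N z) = (y \<circ>\<^sub>N x) \<circ>\<^sub>N z \<ominus>\<^bsub>A\<^esub> y \<circ>\<^sub>N (x \<circ>\<^sub>N z)"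

locale right_novikov_algebra = novikov_algebra K B "\<lambda>a b. diamond b a"
  for K (structure) and B (structure) and diamond (infixl \<open>\<diamondop>\<close> 70)

locale transposed_novikov_poisson_algebra =
  dot: comm_assoc_algebra K A dot + circ: novikov_algebra K A circ
  for K (structure) and A (structure)
    and dot (infixl \<open>\<cdot>\<close> 70) and circ (infixl \<open>\<circ>\<^sub>N\<close> 70) +
  assumes dot_circ_commute: "\<lbrakk>x \<in> carrier A; y \<in> carrier A; z \<in> carrier A\<rbrakk> \<Longrightarrow>
      (x \<cdot> y) \<circ>\<^sub>N z = (x \<cdot> z) \<circ>\<^sub>N y"
    and transposed_leibniz: "\<lbrakk>x \<in> carrier A; y \<in> carrier A; z \<in> carrier A\<rbrakk> \<Longrightarrow>
      [(2::nat)] \<cdot>\<^bsub>A\<^esub> (z \<cdot> (x \<circ>\<^sub>N y)) = (z \<cdot> x) \<circ>\<^sub>N y \<oplus>\<^bsub>A\<^esub> x \<circ>\<^sub>N (z \<cdot> y)"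

locale right_differential_novikov_poisson_algebra =
  dot: comm_assoc_algebra K B dot + diamond: right_novikov_algebra K B diamond
  for K (structure) and B (structure)
    and dot (infixl \<open>\<cdot>\<close> 70) and diamond (infixl \<open>\<diamondop>\<close> 70) +
  assumes diamond_dot: "\<lbrakk>a \<in> carrier B; b \<in> carrier B; c \<in> carrier B\<rbrakk> \<Longrightarrow>
      (a \<diamondop> b) \<cdot> c = a \<diamondop> (b \<cdot> c)"
    and leibniz: "\<lbrakk>a \<in> carrier B; b \<in> carrier B; c \<in> carrier B\<rbrakk> \<Longrightarrow>
      (a \<cdot> b) \<diamondop> c = (a \<diamondop> c) \<cdot> b \<oplus>\<^bsub>B\<^esub> a \<cdot> (b \<diamondop> c)"

locale transposed_poisson_algebra =
  dot: comm_assoc_algebra K L dot + bracket: lie_algebra K L bracket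
  for K (structure) and L (structure)
    and dot (infixl \<open>\<cdot>\<close> 70) and bracket (\<open>\<lbrakk>_,/ _\<rbrakk>\<close>) +
  assumes transposed_leibniz: "x \<in> carrier L \<Longrightarrow> y \<in> carrier L \<Longrightarrow> z \<in> carrier L \<Longrightarrow>
      [(2::nat)] \<cdot>\<^bsub>L\<^esub> (z \<cdot> \<lbrakk>x, y\<rbrakk>) = \<lbrakk>z \<cdot> x, y\<rbrakk> \<oplus>\<^bsub>L\<^esub> \<lbrakk>x, z \<cdot> y\<rbrakk>"

section \<open>The operations on the tensor product\<close>

text \<open>
  The operations are specified as bilinear maps with prescribed values on pure tensors, so that
  their existence is something to be proved. They are unconstrained outside the carrier.
\<close>

definition is_tensor_dot ::
  "('k, 'r) ring_scheme \<Rightarrow> ('k, 'a, 's) module_scheme \<Rightarrow> ('k, 'b, 't) module_scheme \<Rightarrow>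
   ('a \<Rightarrow> 'a \<Rightarrow> 'a) \<Rightarrow> ('b \<Rightarrow> 'b \<Rightarrow> 'b) \<Rightarrow>
   (('a \<times> 'b \<Rightarrow> 'k) set \<Rightarrow> ('a \<times> 'b \<Rightarrow> 'k) set \<Rightarrow> ('a \<times> 'b \<Rightarrow> 'k) set) \<Rightarrow> bool"
  where "is_tensor_dot K A B dot1 dot2 dot \<longleftrightarrow>
    (let T = tensor_product K A B; t = pure_tensor K A B in
      bilinear_map K T T T dot \<and>
      (\<forall>x\<in>carrier A. \<forall>y\<in>carrier A. \<forall>a\<in>carrier B. \<forall>b\<in>carrier B.
        dot (t x a) (t y b) = t (dot1 x y) (dot2 a b)))"

definition is_tensor_bracket ::
  "('k, 'r) ring_scheme \<Rightarrow> ('k, 'a, 's) module_scheme \<Rightarrow> ('k, 'b, 't) module_scheme \<Rightarrow>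
   ('a \<Rightarrow> 'a \<Rightarrow> 'a) \<Rightarrow> ('b \<Rightarrow> 'b \<Rightarrow> 'b) \<Rightarrow>
   (('a \<times> 'b \<Rightarrow> 'k) set \<Rightarrow> ('a \<times> 'b \<Rightarrow> 'k) set \<Rightarrow> ('a \<times> 'b \<Rightarrow> 'k) set) \<Rightarrow> bool"
  where "is_tensor_bracket K A B circ diamond bracket \<longleftrightarrow>
    (let T = tensor_product K A B; t = pure_tensor K A B in
      bilinear_map K T T T bracket \<and>
      (\<forall>x\<in>carrier A. \<forall>y\<in>carrier A. \<forall>a\<in>carrier B. \<forall>b\<in>carrier B.
        bracket (t x a) (t y b) =
          t (circ x y) (diamond a b) \<ominus>\<^bsub>T\<^esub> t (circ y x) (diamond b a)))"

end

theory Submission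
  imports Defs
begin

text \<open>
  There are two separate tasks: the two operations have to exist, and any operations with the
  prescribed values on pure tensors have to satisfy the axioms.

  Existence is the universal property of the tensor product (\<open>tensor_universal_property\<close>): a
  bilinear map on \<open>A \<times> B\<close> factors through the quotient of the free module by the tensor relations.
  Applied once for each argument of a product, it turns a map that is bilinear in \<open>(x, a)\<close> and in
  \<open>(y, b)\<close> into a bilinear map on the tensor product (\<open>tensor_bilinear_extension\<close>).

  For the axioms, pure tensors generate the tensor product additively (\<open>tensor_induct\<close>), so
  multilinear identities need to be checked on pure tensors only. Commutativity and associativity
  hold there factor by factor, and the bracket is antisymmetric by its form. The Jacobi identity
  rests on the fact that the two Novikov axioms leave few independent products of three elements
  in either factor, and that opposite conventions in \<open>A\<close> and \<open>B\<close> make the corresponding tensors cancel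
  in the cyclic sum (\<open>jacobi_pure\<close>). In the transposed Leibniz rule, the derivation property of
  \<open>B\<close> produces one unwanted tensor from each of the two brackets; the exchange rules
  \<open>hx \<circ> y = hy \<circ> x\<close> and \<open>(d \<diamondop> a)b = d \<diamondop> ab\<close> make these equal, and what remains is the transposed
  Leibniz rule of \<open>A\<close>, tensored with \<open>B\<close> (\<open>transposed_leibniz_pure\<close>).
\<close>

section \<open>Linear and bilinear maps\<close>

definition linear_map ::
  "('k, 'r) ring_scheme \<Rightarrow> ('k, 'v, 's) module_scheme \<Rightarrow> ('k, 'w, 't) module_scheme \<Rightarrow>
   ('v \<Rightarrow> 'w) \<Rightarrow> bool"
  where "linear_map K V W h \<longleftrightarrow>
    (\<forall>v\<in>carrier V. h v \<in> carrier W) \<and>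
    (\<forall>v\<in>carrier V. \<forall>v'\<in>carrier V. h (v \<oplus>\<^bsub>V\<^esub> v') = h v \<oplus>\<^bsub>W\<^esub> h v') \<and>
    (\<forall>c\<in>carrier K. \<forall>v\<in>carrier V. h (c \<odot>\<^bsub>V\<^esub> v) = c \<odot>\<^bsub>W\<^esub> h v)"

lemma linear_mapD:
  assumes "linear_map K V W h" and "v \<in> carrier V"
  shows "h v \<in> carrier W"
    and "v' \<in> carrier V \<Longrightarrow> h (v \<oplus>\<^bsub>V\<^esub> v') = h v \<oplus>\<^bsub>W\<^esub> h v'"
    and "c \<in> carrier K \<Longrightarrow> h (c \<odot>\<^bsub>V\<^esub> v) = c \<odot>\<^bsub>W\<^esub> h v"
  using assms by (simp_all add: linear_map_def)

lemma linear_map_zero: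
  assumes "module K V" and "module K W" and h: "linear_map K V W h"
  shows "h \<zero>\<^bsub>V\<^esub> = \<zero>\<^bsub>W\<^esub>"
proof -
  interpret V: module K V by fact
  interpret W: module K W by fact
  have "h (\<zero>\<^bsub>K\<^esub> \<odot>\<^bsub>V\<^esub> \<zero>\<^bsub>V\<^esub>) = \<zero>\<^bsub>K\<^esub> \<odot>\<^bsub>W\<^esub> h \<zero>\<^bsub>V\<^esub>"
    using linear_mapD(3)[OF h, of "\<zero>\<^bsub>V\<^esub>" "\<zero>\<^bsub>K\<^esub>"] by simp
  then show ?thesis using linear_mapD(1)[OF h] by simp
qed

lemma linear_map_minus:
  assumes "module K V" and "module K W" and h: "linear_map K V W h"
    and v: "v \<in> carrier V" "v' \<in> carrier V"
  shows "h (\<ominus>\<^bsub>V\<^esub> v) = \<ominus>\<^bsub>W\<^esub> h v" and "h (v \<ominus>\<^bsub>V\<^esub> v') = h v \<ominus>\<^bsub>W\<^esub> h v'"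
proof -
  interpret V: module K V by fact
  interpret W: module K W by fact
  have "h (\<ominus>\<^bsub>V\<^esub> u) = \<ominus>\<^bsub>W\<^esub> h u" if u: "u \<in> carrier V" for u
  proof -
    have "h u \<oplus>\<^bsub>W\<^esub> h (\<ominus>\<^bsub>V\<^esub> u) = \<zero>\<^bsub>W\<^esub>"
      using linear_mapD(2)[OF h u, of "\<ominus>\<^bsub>V\<^esub> u"] u linear_map_zero[OF assms(1-3)]
      by (simp add: V.M.r_neg)
    then show ?thesis
      using linear_mapD(1)[OF h] u
      by (intro W.M.minus_equality[symmetric]) (simp_all add: W.M.a_comm)
  qed
  then show "h (\<ominus>\<^bsub>V\<^esub> v) = \<ominus>\<^bsub>W\<^esub> h v" and "h (v \<ominus>\<^bsub>V\<^esub> v') = h v \<ominus>\<^bsub>W\<^esub> h v'"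
    using v linear_mapD(2)[OF h] by (simp_all add: V.M.minus_eq W.M.minus_eq)
qed

text \<open>
  A linear map annihilates the submodule generated by a set as soon as it annihilates the set;
  this is how maps are shown to respect the tensor relations.
\<close>

lemma submodule_zero_set:
  assumes "module K V" and "module K W" and h: "linear_map K V W h"
  shows "submodule {v \<in> carrier V. h v = \<zero>\<^bsub>W\<^esub>} K V"
proof -
  interpret V: module K V by fact
  interpret W: module K W by fact
  show ?thesis
    by (rule V.submoduleI)
      (use linear_mapD[OF h] linear_map_zero[OF assms] linear_map_minus[OF assms] in auto)
qed

text \<open>
  Bilinearity and linearity in each argument are interchangeable, so the closure properties
  of linear maps serve for maps of several arguments as well.
\<close>

lemma bilinear_mapI:
  assumes "\<And>v. v \<in> carrier V \<Longrightarrow> linear_map K U W (\<lambda>u. f u v)"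
    and "\<And>u. u \<in> carrier U \<Longrightarrow> linear_map K V W (f u)"
  shows "bilinear_map K U V W f"
  using assms by (simp add: bilinear_map_def linear_map_def)

lemma bilinear_map_linear:
  assumes "bilinear_map K U V W f"
  shows "v \<in> carrier V \<Longrightarrow> linear_map K U W (\<lambda>u. f u v)"
    and "u \<in> carrier U \<Longrightarrow> linear_map K V W (f u)"
  using assms by (simp_all add: bilinear_map_def linear_map_def)

lemma bilinear_map_closed:
  assumes "bilinear_map K U V W f" and "u \<in> carrier U" and "v \<in> carrier V"
  shows "f u v \<in> carrier W"
  using assms by (simp add: bilinear_map_def)

lemma bilinear_map_add:
  assumes "bilinear_map K U V W f" and "u \<in> carrier U" and "v \<in> carrier V"
  shows "u' \<in> carrier U \<Longrightarrow> f (u \<oplus>\<^bsub>U\<^esub> u') v = f u v \<oplus>\<^bsub>W\<^esub> f u' v"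
    and "v' \<in> carrier V \<Longrightarrow> f u (v \<oplus>\<^bsub>V\<^esub> v') = f u v \<oplus>\<^bsub>W\<^esub> f u v'"
  using assms by (simp_all add: bilinear_map_def)

lemma bilinear_map_smult:
  assumes "bilinear_map K U V W f" and "u \<in> carrier U" and "v \<in> carrier V" and "c \<in> carrier K"
  shows "f (c \<odot>\<^bsub>U\<^esub> u) v = c \<odot>\<^bsub>W\<^esub> f u v" and "f u (c \<odot>\<^bsub>V\<^esub> v) = c \<odot>\<^bsub>W\<^esub> f u v"
  using assms by (simp_all add: bilinear_map_def)

lemma bilinear_map_minus:
  assumes "module K U" and "module K V" and "module K W" and f: "bilinear_map K U V W f"
    and u: "u \<in> carrier U" and v: "v \<in> carrier V"
  shows "u' \<in> carrier U \<Longrightarrow> f (u \<ominus>\<^bsub>U\<^esub> u') v = f u v \<ominus>\<^bsub>W\<^esub> f u' v"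
    and "v' \<in> carrier V \<Longrightarrow> f u (v \<ominus>\<^bsub>V\<^esub> v') = f u v \<ominus>\<^bsub>W\<^esub> f u v'"
  using linear_map_minus(2)[OF assms(1,3) bilinear_map_linear(1)[OF f v] u]
    linear_map_minus(2)[OF assms(2,3) bilinear_map_linear(2)[OF f u] v] by auto

lemma linear_map_ident: "linear_map K V V (\<lambda>v. v)"
  by (simp add: linear_map_def)

lemma linear_map_comp:
  assumes "linear_map K U V f" and "linear_map K V W g"
  shows "linear_map K U W (\<lambda>u. g (f u))"
  using assms by (simp add: linear_map_def)

lemma linear_map_add_maps:
  assumes "module K W" and f: "linear_map K V W f" and g: "linear_map K V W g"
  shows "linear_map K V W (\<lambda>v. f v \<oplus>\<^bsub>W\<^esub> g v)"
proof -
  interpret W: module K W by fact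
  show ?thesis
    using f g by (simp add: linear_map_def W.smult_r_distr W.M.a_ac)
qed

lemma linear_map_smult_map:
  assumes "module K W" and c: "c \<in> carrier K" and f: "linear_map K V W f"
  shows "linear_map K V W (\<lambda>v. c \<odot>\<^bsub>W\<^esub> f v)"
proof -
  interpret W: module K W by fact
  show ?thesis
    using f c by (simp add: linear_map_def W.smult_r_distr W.smult_assoc1[symmetric] W.R.m_comm)
qed

lemma linear_map_zero_map:
  assumes "module K W"
  shows "linear_map K V W (\<lambda>v. \<zero>\<^bsub>W\<^esub>)"
proof -
  interpret W: module K W by fact
  show ?thesis by (simp add: linear_map_def)
qed

lemma linear_map_diff_maps:
  assumes "module K W" and f: "linear_map K V W f" and g: "linear_map K V W g"
  shows "linear_map K V W (\<lambda>v. f v \<ominus>\<^bsub>W\<^esub> g v)"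
proof -
  interpret W: module K W by fact
  show ?thesis
    using f g
    by (simp add: linear_map_def W.M.minus_eq W.M.minus_add W.smult_r_distr W.smult_r_minus W.M.a_ac)
qed

lemma bilinear_map_comp:
  assumes "bilinear_map K U V W f" and "linear_map K U' U p" and "linear_map K V' V q"
  shows "bilinear_map K U' V' W (\<lambda>u v. f (p u) (q v))"
  using assms by (simp add: bilinear_map_def linear_map_def)

lemma bilinear_map_diff:
  assumes "module K W" and "bilinear_map K U V W f" and "bilinear_map K U V W g"
  shows "bilinear_map K U V W (\<lambda>u v. f u v \<ominus>\<^bsub>W\<^esub> g u v)"
  using assms by (intro bilinear_mapI linear_map_diff_maps) (simp_all add: bilinear_map_linear)

section \<open>Free modules and linear extension\<close>

lemma module_free_module:
  assumes "cring K"
  shows "module K (free_module K I)"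
proof -
  interpret K: cring K by fact
  let ?F = "free_module K I"
  have *: "f i \<in> carrier K" if "f \<in> carrier ?F" for f i
    using that by (auto simp: free_module_def)
  have supp: "finite {i. f i \<noteq> \<zero>\<^bsub>K\<^esub>} \<and> {i. f i \<noteq> \<zero>\<^bsub>K\<^esub>} \<subseteq> I" if "f \<in> carrier ?F" for f
    using that by (auto simp: free_module_def)
  have carrI: "f \<in> carrier ?F" if "\<And>i. f i \<in> carrier K" "finite S" "S \<subseteq> I"
    "\<And>i. i \<notin> S \<Longrightarrow> f i = \<zero>\<^bsub>K\<^esub>" for f S
  proof -
    have "{i. f i \<noteq> \<zero>\<^bsub>K\<^esub>} \<subseteq> S" using that(4) by blast
    then show ?thesis
      using that(1-3) by (auto simp: free_module_def intro: finite_subset)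
  qed
  have add: "f \<oplus>\<^bsub>?F\<^esub> g = (\<lambda>i. f i \<oplus>\<^bsub>K\<^esub> g i)" for f g by (simp add: free_module_def)
  have zero: "\<zero>\<^bsub>?F\<^esub> = (\<lambda>i. \<zero>\<^bsub>K\<^esub>)" by (simp add: free_module_def)
  have smult: "c \<odot>\<^bsub>?F\<^esub> f = (\<lambda>i. c \<otimes>\<^bsub>K\<^esub> f i)" for c f by (simp add: free_module_def)
  show ?thesis
  proof (intro moduleI abelian_groupI)
    fix f g assume fg: "f \<in> carrier ?F" "g \<in> carrier ?F"
    show "f \<oplus>\<^bsub>?F\<^esub> g \<in> carrier ?F"
      by (rule carrI[where S = "{i. f i \<noteq> \<zero>\<^bsub>K\<^esub>} \<union> {i. g i \<noteq> \<zero>\<^bsub>K\<^esub>}"])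
        (use fg * supp in \<open>auto simp: add\<close>)
  next
    show "\<zero>\<^bsub>?F\<^esub> \<in> carrier ?F" by (rule carrI[where S = "{}"]) (auto simp: zero)
  next
    fix c f assume cf: "c \<in> carrier K" "f \<in> carrier ?F"
    show "c \<odot>\<^bsub>?F\<^esub> f \<in> carrier ?F"
      by (rule carrI[where S = "{i. f i \<noteq> \<zero>\<^bsub>K\<^esub>}"]) (use cf * supp in \<open>auto simp: smult\<close>)
  next
    fix f assume f: "f \<in> carrier ?F"
    have "(\<lambda>i. \<ominus>\<^bsub>K\<^esub> f i) \<in> carrier ?F"
      by (rule carrI[where S = "{i. f i \<noteq> \<zero>\<^bsub>K\<^esub>}"]) (use f * supp in auto)
    then show "\<exists>g\<in>carrier ?F. g \<oplus>\<^bsub>?F\<^esub> f = \<zero>\<^bsub>?F\<^esub>"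
      by (rule bexI[rotated]) (use f * in \<open>auto simp: add zero K.l_neg\<close>)
  qed (use * in \<open>auto simp: add zero smult K.a_ac K.m_ac K.l_distr K.r_distr K.is_cring\<close>)
qed

lemma free_gen_closed:
  assumes "cring K" and "i \<in> I"
  shows "free_gen K i \<in> carrier (free_module K I)"
proof -
  interpret K: cring K by fact
  have "{j. free_gen K i j \<noteq> \<zero>\<^bsub>K\<^esub>} \<subseteq> {i}" by (auto simp: free_gen_def)
  then show ?thesis
    using assms(2) by (auto simp: free_module_def free_gen_def intro: finite_subset)
qed

text \<open>
  An element with support in a finite set is a combination of one generator fewer after the
  value at one point of that set has been reset to zero.
\<close>

lemma free_module_induct [consumes 2, case_names zero add]:
  assumes "cring K" and f: "f \<in> carrier (free_module K I)"
    and zero: "P \<zero>\<^bsub>free_module K I\<^esub>"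
    and add: "\<And>c i g. \<lbrakk>c \<in> carrier K; i \<in> I; g \<in> carrier (free_module K I); P g\<rbrakk> \<Longrightarrow>
      P (c \<odot>\<^bsub>free_module K I\<^esub> free_gen K i \<oplus>\<^bsub>free_module K I\<^esub> g)"
  shows "P f"
proof -
  interpret K: cring K by fact
  let ?F = "free_module K I"
  have "f \<in> carrier ?F \<Longrightarrow> {i. f i \<noteq> \<zero>\<^bsub>K\<^esub>} \<subseteq> S \<Longrightarrow> P f" if "finite S" "S \<subseteq> I" for S
    using that
  proof (induction S arbitrary: f)
    case empty
    then have "f = \<zero>\<^bsub>?F\<^esub>" by (auto simp: free_module_def)
    then show ?case using zero by simp
  next
    case (insert i S)
    let ?g = "f(i := \<zero>\<^bsub>K\<^esub>)"
    have fK: "f j \<in> carrier K" for j using insert.prems(1) by (auto simp: free_module_def)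
    have "{j. ?g j \<noteq> \<zero>\<^bsub>K\<^esub>} \<subseteq> S" using insert.prems(2) by auto
    moreover from this have g: "?g \<in> carrier ?F"
      using insert.prems insert.hyps fK by (auto simp: free_module_def intro: finite_subset)
    ultimately have "P ?g" using insert.IH[of ?g] insert.prems(3) by blast
    moreover have "f = f i \<odot>\<^bsub>?F\<^esub> free_gen K i \<oplus>\<^bsub>?F\<^esub> ?g"
      using fK by (auto simp: free_module_def free_gen_def)
    ultimately show ?case using add[OF fK[of i] _ g, of i] insert.prems(3) by (metis insert_subset)
  qed
  then show ?thesis using f by (auto simp: free_module_def)
qed

definition free_lift :: "('k, 'r) ring_scheme \<Rightarrow> ('k, 'w, 's) module_scheme \<Rightarrow> ('i \<Rightarrow> 'w) \<Rightarrow>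
   ('i \<Rightarrow> 'k) \<Rightarrow> 'w"
  where "free_lift K W \<phi> f = (\<Oplus>\<^bsub>W\<^esub>i\<in>{i. f i \<noteq> \<zero>\<^bsub>K\<^esub>}. f i \<odot>\<^bsub>W\<^esub> \<phi> i)"

lemma free_lift_gen:
  assumes "module K W" and "\<phi> i \<in> carrier W"
  shows "free_lift K W \<phi> (free_gen K i) = \<phi> i"
proof -
  interpret W: module K W by fact
  \<comment> \<open>Over the zero ring a generator has empty support, but there every module is trivial.\<close>
  show ?thesis
  proof (cases "\<one>\<^bsub>K\<^esub> = \<zero>\<^bsub>K\<^esub>")
    case True
    have "\<phi> i = \<one>\<^bsub>K\<^esub> \<odot>\<^bsub>W\<^esub> \<phi> i" using assms by simp
    then have "\<phi> i = \<zero>\<^bsub>W\<^esub>" unfolding True using assms by simp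
    then show ?thesis by (simp add: free_lift_def free_gen_def True)
  next
    case False
    then have "{j. free_gen K i j \<noteq> \<zero>\<^bsub>K\<^esub>} = {i}" by (auto simp: free_gen_def)
    then show ?thesis using assms by (simp add: free_lift_def free_gen_def)
  qed
qed

lemma linear_map_free_lift:
  assumes "module K W" and \<phi>: "\<And>i. i \<in> I \<Longrightarrow> \<phi> i \<in> carrier W"
  shows "linear_map K (free_module K I) W (free_lift K W \<phi>)"
proof -
  interpret W: module K W by fact
  let ?F = "free_module K I"
  have fK: "f i \<in> carrier K" if "f \<in> carrier ?F" for f i
    using that by (auto simp: free_module_def)
  \<comment> \<open>The support of a sum may be smaller than the union of the supports, so the sums are
    compared over a common finite index set.\<close>
  have sum: "free_lift K W \<phi> f = (\<Oplus>\<^bsub>W\<^esub>i\<in>S. f i \<odot>\<^bsub>W\<^esub> \<phi> i)"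
    if "f \<in> carrier ?F" "{i. f i \<noteq> \<zero>\<^bsub>K\<^esub>} \<subseteq> S" "finite S" "S \<subseteq> I" for f S
    unfolding free_lift_def
    by (rule W.add.finprod_mono_neutral_cong_left) (use that fK \<phi> in \<open>auto simp: Pi_def subset_iff\<close>)
  have supp: "finite {i. f i \<noteq> \<zero>\<^bsub>K\<^esub>}" "{i. f i \<noteq> \<zero>\<^bsub>K\<^esub>} \<subseteq> I" if "f \<in> carrier ?F" for f
    using that by (auto simp: free_module_def)
  interpret F: module K ?F by (rule module_free_module) (rule W.R.is_cring)
  show ?thesis
    unfolding linear_map_def
  proof (intro conjI ballI)
    fix f assume f: "f \<in> carrier ?F"
    show "free_lift K W \<phi> f \<in> carrier W"
      using supp[OF f] fK[OF f] \<phi> unfolding free_lift_def by (auto intro!: W.M.finsum_closed)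
    fix g assume g: "g \<in> carrier ?F"
    let ?S = "{i. f i \<noteq> \<zero>\<^bsub>K\<^esub>} \<union> {i. g i \<noteq> \<zero>\<^bsub>K\<^esub>}"
    have add: "f \<oplus>\<^bsub>?F\<^esub> g = (\<lambda>i. f i \<oplus>\<^bsub>K\<^esub> g i)" by (simp add: free_module_def)
    have S: "finite ?S" "?S \<subseteq> I" using supp f g by auto
    have "free_lift K W \<phi> (f \<oplus>\<^bsub>?F\<^esub> g) = (\<Oplus>\<^bsub>W\<^esub>i\<in>?S. f i \<odot>\<^bsub>W\<^esub> \<phi> i \<oplus>\<^bsub>W\<^esub> g i \<odot>\<^bsub>W\<^esub> \<phi> i)"
    proof (subst sum[where S = ?S])
      have "\<phi> i \<in> carrier W" if "i \<in> ?S" for i using that S(2) \<phi> by blast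
      then show "(\<Oplus>\<^bsub>W\<^esub>i\<in>?S. (f \<oplus>\<^bsub>?F\<^esub> g) i \<odot>\<^bsub>W\<^esub> \<phi> i) =
          (\<Oplus>\<^bsub>W\<^esub>i\<in>?S. f i \<odot>\<^bsub>W\<^esub> \<phi> i \<oplus>\<^bsub>W\<^esub> g i \<odot>\<^bsub>W\<^esub> \<phi> i)"
        using fK f g by (intro W.M.finsum_cong') (auto simp: add W.smult_l_distr)
    qed (use S f g F.M.a_closed[OF f g] in \<open>auto simp: add\<close>)
    also have "\<dots> = (\<Oplus>\<^bsub>W\<^esub>i\<in>?S. f i \<odot>\<^bsub>W\<^esub> \<phi> i) \<oplus>\<^bsub>W\<^esub> (\<Oplus>\<^bsub>W\<^esub>i\<in>?S. g i \<odot>\<^bsub>W\<^esub> \<phi> i)"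
      by (rule W.M.finsum_addf) (use S(2) fK f g \<phi> in \<open>auto simp: Pi_def subset_iff\<close>)
    also have "\<dots> = free_lift K W \<phi> f \<oplus>\<^bsub>W\<^esub> free_lift K W \<phi> g"
      using S f g by (simp add: sum[where S = ?S])
    finally show "free_lift K W \<phi> (f \<oplus>\<^bsub>?F\<^esub> g) = free_lift K W \<phi> f \<oplus>\<^bsub>W\<^esub> free_lift K W \<phi> g" .
  next
    fix c f assume c: "c \<in> carrier K" and f: "f \<in> carrier ?F"
    let ?S = "{i. f i \<noteq> \<zero>\<^bsub>K\<^esub>}"
    have smult: "c \<odot>\<^bsub>?F\<^esub> f = (\<lambda>i. c \<otimes>\<^bsub>K\<^esub> f i)" by (simp add: free_module_def)
    have "free_lift K W \<phi> (c \<odot>\<^bsub>?F\<^esub> f) = (\<Oplus>\<^bsub>W\<^esub>i\<in>?S. c \<odot>\<^bsub>W\<^esub> (f i \<odot>\<^bsub>W\<^esub> \<phi> i))"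
      using supp f c fK[OF f] \<phi>
      by (subst sum[where S = ?S])
        (auto simp: smult W.smult_assoc1 subset_iff F.smult_closed[OF c f, unfolded smult]
          intro!: W.M.finsum_cong')
    also have "\<dots> = c \<odot>\<^bsub>W\<^esub> free_lift K W \<phi> f"
      unfolding free_lift_def
      by (rule W.finsum_smult_ldistr[symmetric])
        (use supp[OF f] c fK[OF f] \<phi> in \<open>auto simp: Pi_def subset_iff\<close>)
    finally show "free_lift K W \<phi> (c \<odot>\<^bsub>?F\<^esub> f) = c \<odot>\<^bsub>W\<^esub> free_lift K W \<phi> f" .
  qed
qed

section \<open>Quotient modules\<close>

lemma submodule_generated_least:
  assumes "submodule H K V" and "S \<subseteq> H"
  shows "submodule_generated K V S \<subseteq> H"
  using assms by (auto simp: submodule_generated_def)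

lemma (in module) submodule_submodule_generated:
  assumes "S \<subseteq> carrier M"
  shows "submodule (submodule_generated R M S) R M" and "S \<subseteq> submodule_generated R M S"
proof -
  show "submodule (submodule_generated R M S) R M"
  proof (rule submoduleI)
    show "submodule_generated R M S \<subseteq> carrier M"
      using submodule_generated_least[OF carrier_is_submodule assms] .
    show "\<zero>\<^bsub>M\<^esub> \<in> submodule_generated R M S"
      unfolding submodule_generated_def
      using submodule.axioms(1) subgroup.one_closed by fastforce
  qed (auto simp: submodule_generated_def dest: submoduleE(3,4,5))
  show "S \<subseteq> submodule_generated R M S" by (auto simp: submodule_generated_def)
qed

context module
begin

lemma abelian_subgroup_submodule:
  assumes "submodule N R M"
  shows "abelian_subgroup N M"
  using submodule.axioms(1)[OF assms] abelian_group_axioms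
  by (intro abelian_subgroupI3 additive_subgroup.intro)

lemma quotient_module_simps:
  assumes N: "submodule N R M"
  shows "carrier (quotient_module M N) = (\<lambda>v. N +>\<^bsub>M\<^esub> v) ` carrier M"
    and "\<zero>\<^bsub>quotient_module M N\<^esub> = N +>\<^bsub>M\<^esub> \<zero>\<^bsub>M\<^esub>"
    and "\<lbrakk>v \<in> carrier M; w \<in> carrier M\<rbrakk> \<Longrightarrow>
      (N +>\<^bsub>M\<^esub> v) \<oplus>\<^bsub>quotient_module M N\<^esub> (N +>\<^bsub>M\<^esub> w) = N +>\<^bsub>M\<^esub> (v \<oplus>\<^bsub>M\<^esub> w)"
    and "\<lbrakk>c \<in> carrier R; v \<in> carrier M\<rbrakk> \<Longrightarrow>
      c \<odot>\<^bsub>quotient_module M N\<^esub> (N +>\<^bsub>M\<^esub> v) = N +>\<^bsub>M\<^esub> (c \<odot>\<^bsub>M\<^esub> v)"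
proof -
  interpret N: abelian_subgroup N M by (rule abelian_subgroup_submodule) fact
  show "carrier (quotient_module M N) = (\<lambda>v. N +>\<^bsub>M\<^esub> v) ` carrier M"
    by (auto simp: quotient_module_def A_RCOSETS_def')
  show "\<zero>\<^bsub>quotient_module M N\<^esub> = N +>\<^bsub>M\<^esub> \<zero>\<^bsub>M\<^esub>"
    using N.a_subset by (simp add: quotient_module_def)
  show "(N +>\<^bsub>M\<^esub> v) \<oplus>\<^bsub>quotient_module M N\<^esub> (N +>\<^bsub>M\<^esub> w) = N +>\<^bsub>M\<^esub> (v \<oplus>\<^bsub>M\<^esub> w)"
    if "v \<in> carrier M" "w \<in> carrier M"
    using that by (simp add: quotient_module_def N.a_rcos_sum)
  assume c: "c \<in> carrier R" and v: "v \<in> carrier M"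
  have "N +>\<^bsub>M\<^esub> (c \<odot>\<^bsub>M\<^esub> w) = N +>\<^bsub>M\<^esub> (c \<odot>\<^bsub>M\<^esub> v)" if w: "w \<in> N +>\<^bsub>M\<^esub> v" for w
  proof -
    obtain n where n: "n \<in> N" and w_eq: "w = n \<oplus>\<^bsub>M\<^esub> v"
      using w by (auto simp: a_r_coset_def')
    have "c \<odot>\<^bsub>M\<^esub> w = c \<odot>\<^bsub>M\<^esub> n \<oplus>\<^bsub>M\<^esub> c \<odot>\<^bsub>M\<^esub> v"
      using n v c N.a_subset by (auto simp: w_eq smult_r_distr)
    moreover have "c \<odot>\<^bsub>M\<^esub> n \<in> N" using submoduleE(4)[OF N c n] .
    ultimately have "c \<odot>\<^bsub>M\<^esub> w \<in> N +>\<^bsub>M\<^esub> (c \<odot>\<^bsub>M\<^esub> v)" by (auto simp: a_r_coset_def')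
    then show ?thesis using c v N.a_repr_independence' by simp
  qed
  moreover have "v \<in> N +>\<^bsub>M\<^esub> v" using v N.a_rcos_self by simp
  ultimately have "(\<Union>w\<in>N +>\<^bsub>M\<^esub> v. N +>\<^bsub>M\<^esub> (c \<odot>\<^bsub>M\<^esub> w)) = N +>\<^bsub>M\<^esub> (c \<odot>\<^bsub>M\<^esub> v)"
    by blast
  then show "c \<odot>\<^bsub>quotient_module M N\<^esub> (N +>\<^bsub>M\<^esub> v) = N +>\<^bsub>M\<^esub> (c \<odot>\<^bsub>M\<^esub> v)"
    by (simp add: quotient_module_def)
qed

lemma module_quotient_module:
  assumes N: "submodule N R M"
  shows "module R (quotient_module M N)"
proof (intro moduleI abelian_groupI)
  show "cring R" by (rule R.is_cring)
  fix X assume "X \<in> carrier (quotient_module M N)"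
  then obtain v where v: "v \<in> carrier M" and X: "X = N +>\<^bsub>M\<^esub> v"
    by (auto simp: quotient_module_simps[OF N])
  show "\<exists>Y\<in>carrier (quotient_module M N). Y \<oplus>\<^bsub>quotient_module M N\<^esub> X = \<zero>\<^bsub>quotient_module M N\<^esub>"
    by (rule bexI[of _ "N +>\<^bsub>M\<^esub> (\<ominus>\<^bsub>M\<^esub> v)"])
      (use v in \<open>auto simp: X quotient_module_simps[OF N] M.l_neg\<close>)
qed (auto simp: quotient_module_simps[OF N] M.a_ac smult_l_distr smult_r_distr smult_assoc1)

text \<open>
  A linear map that vanishes on \<open>N\<close> is constant on every coset, so its value on a coset is the
  only element of the image of that coset.
\<close>

lemma quotient_module_lift:
  assumes N: "submodule N R M" and "module R W" and h: "linear_map R M W h"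
    and vanish: "\<And>n. n \<in> N \<Longrightarrow> h n = \<zero>\<^bsub>W\<^esub>"
  obtains h' where "linear_map R (quotient_module M N) W h'"
    and "\<And>v. v \<in> carrier M \<Longrightarrow> h' (N +>\<^bsub>M\<^esub> v) = h v"
proof
  interpret W: module R W by fact
  let ?h = "\<lambda>X. the_elem (h ` X)"
  show eq: "?h (N +>\<^bsub>M\<^esub> v) = h v" if v: "v \<in> carrier M" for v
  proof -
    interpret N: abelian_subgroup N M by (rule abelian_subgroup_submodule) fact
    have "h ` (N +>\<^bsub>M\<^esub> v) = {h v}"
    proof -
      have "h w = h v" if "w \<in> N +>\<^bsub>M\<^esub> v" for w
        using that v N.a_subset vanish linear_mapD[OF h] by (auto simp: a_r_coset_def')
      moreover have "v \<in> N +>\<^bsub>M\<^esub> v" using v N.a_rcos_self by simp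
      ultimately show ?thesis by blast
    qed
    then show ?thesis by simp
  qed
  show "linear_map R (quotient_module M N) W ?h"
    using linear_mapD[OF h] unfolding linear_map_def
    by (auto simp: quotient_module_simps[OF N] eq)
qed

end

lemma (in module) coset_eqI:
  assumes N: "submodule N R M" and "v \<in> carrier M" and "w \<in> carrier M" and "v \<ominus>\<^bsub>M\<^esub> w \<in> N"
  shows "N +>\<^bsub>M\<^esub> v = N +>\<^bsub>M\<^esub> w"
proof -
  interpret N: abelian_subgroup N M by (rule abelian_subgroup_submodule) fact
  have "v \<in> N +>\<^bsub>M\<^esub> w" using assms by (simp add: N.a_rcos_module M.minus_eq)
  then show ?thesis using N.a_repr_independence'[of v w] assms by simp
qed

section \<open>The tensor product and its universal property\<close>

locale module_pair = A: module K A + B: module K B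
  for K (structure) and A and B
begin

abbreviation F where "F \<equiv> free_module K (carrier A \<times> carrier B)"
abbreviation T where "T \<equiv> tensor_product K A B"
abbreviation t where "t \<equiv> pure_tensor K A B"
abbreviation e where "e x a \<equiv> free_gen K (x, a)"

sublocale F: module K F
  by (rule module_free_module) (rule A.R.is_cring)

lemma e_closed: "x \<in> carrier A \<Longrightarrow> a \<in> carrier B \<Longrightarrow> e x a \<in> carrier F"
  by (rule free_gen_closed) (auto intro: A.R.is_cring)

lemma tensor_relations_subset: "tensor_relations K A B \<subseteq> carrier F"
  unfolding tensor_relations_def Let_def by (auto intro!: F.M.minus_closed e_closed)

lemmas submodule_tensor_kernel =
  F.submodule_submodule_generated(1)[OF tensor_relations_subset, folded tensor_kernel_def]

lemma module_tensor_product: "module K T"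
  unfolding tensor_product_def by (rule F.module_quotient_module[OF submodule_tensor_kernel])

sublocale T: module K T
  by (rule module_tensor_product)

lemma pure_tensor_closed: "x \<in> carrier A \<Longrightarrow> a \<in> carrier B \<Longrightarrow> t x a \<in> carrier T"
  unfolding tensor_product_def pure_tensor_def
  by (simp add: F.quotient_module_simps[OF submodule_tensor_kernel] e_closed)

lemma bilinear_pure_tensor: "bilinear_map K A B T t"
proof -
  let ?N = "tensor_kernel K A B"
  note q = F.quotient_module_simps(3,4)[OF submodule_tensor_kernel]
  have rel: "?N +>\<^bsub>F\<^esub> v = ?N +>\<^bsub>F\<^esub> w"
    if "v \<ominus>\<^bsub>F\<^esub> w \<in> tensor_relations K A B" "v \<in> carrier F" "w \<in> carrier F" for v w
    using that F.submodule_submodule_generated(2)[OF tensor_relations_subset]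
    by (intro F.coset_eqI[OF submodule_tensor_kernel]) (auto simp: tensor_kernel_def)
  show ?thesis
    unfolding bilinear_map_def
  proof (intro conjI ballI)
    fix x a assume xa: "x \<in> carrier A" "a \<in> carrier B"
    then show "t x a \<in> carrier T" by (rule pure_tensor_closed)
    fix c assume c: "c \<in> carrier K"
    have "e (c \<odot>\<^bsub>A\<^esub> x) a \<ominus>\<^bsub>F\<^esub> c \<odot>\<^bsub>F\<^esub> e x a \<in> tensor_relations K A B"
      "e x (c \<odot>\<^bsub>B\<^esub> a) \<ominus>\<^bsub>F\<^esub> c \<odot>\<^bsub>F\<^esub> e x a \<in> tensor_relations K A B"
      unfolding tensor_relations_def Let_def using xa c by blast+
    then show "t (c \<odot>\<^bsub>A\<^esub> x) a = c \<odot>\<^bsub>T\<^esub> t x a" "t x (c \<odot>\<^bsub>B\<^esub> a) = c \<odot>\<^bsub>T\<^esub> t x a"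
      using xa c by (simp_all add: tensor_product_def pure_tensor_def q e_closed rel)
  next
    fix x y a assume xa: "x \<in> carrier A" "y \<in> carrier A" "a \<in> carrier B"
    then have "e (x \<oplus>\<^bsub>A\<^esub> y) a \<ominus>\<^bsub>F\<^esub> (e x a \<oplus>\<^bsub>F\<^esub> e y a) \<in> tensor_relations K A B"
      unfolding tensor_relations_def Let_def by blast
    then show "t (x \<oplus>\<^bsub>A\<^esub> y) a = t x a \<oplus>\<^bsub>T\<^esub> t y a"
      using xa by (simp add: tensor_product_def pure_tensor_def q e_closed rel)
  next
    fix x a b assume xa: "x \<in> carrier A" "a \<in> carrier B" "b \<in> carrier B"
    then have "e x (a \<oplus>\<^bsub>B\<^esub> b) \<ominus>\<^bsub>F\<^esub> (e x a \<oplus>\<^bsub>F\<^esub> e x b) \<in> tensor_relations K A B"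
      unfolding tensor_relations_def Let_def by blast
    then show "t x (a \<oplus>\<^bsub>B\<^esub> b) = t x a \<oplus>\<^bsub>T\<^esub> t x b"
      using xa by (simp add: tensor_product_def pure_tensor_def q e_closed rel)
  qed
qed

text \<open>
  Scalars are absorbed into the first factor, so every tensor is a sum of pure tensors and the
  induction needs no case for scalar multiples.
\<close>

lemma tensor_induct [consumes 1, case_names pure add]:
  assumes u: "u \<in> carrier T"
    and pure: "\<And>x a. x \<in> carrier A \<Longrightarrow> a \<in> carrier B \<Longrightarrow> P (t x a)"
    and add: "\<And>u v. \<lbrakk>u \<in> carrier T; v \<in> carrier T; P u; P v\<rbrakk> \<Longrightarrow> P (u \<oplus>\<^bsub>T\<^esub> v)"
  shows "P u"
proof -
  let ?N = "tensor_kernel K A B"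
  note q = F.quotient_module_simps[OF submodule_tensor_kernel, folded tensor_product_def]
  have scaled: "P (?N +>\<^bsub>F\<^esub> (c \<odot>\<^bsub>F\<^esub> e x a))" "?N +>\<^bsub>F\<^esub> (c \<odot>\<^bsub>F\<^esub> e x a) \<in> carrier T"
    if c: "c \<in> carrier K" and xa: "x \<in> carrier A" "a \<in> carrier B" for c x a
  proof -
    have "?N +>\<^bsub>F\<^esub> (c \<odot>\<^bsub>F\<^esub> e x a) = t (c \<odot>\<^bsub>A\<^esub> x) a"
      using bilinear_map_smult(1)[OF bilinear_pure_tensor xa c] c xa
      by (simp add: pure_tensor_def q e_closed)
    then show "P (?N +>\<^bsub>F\<^esub> (c \<odot>\<^bsub>F\<^esub> e x a))" "?N +>\<^bsub>F\<^esub> (c \<odot>\<^bsub>F\<^esub> e x a) \<in> carrier T"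
      using pure c xa by (simp_all add: pure_tensor_closed)
  qed
  obtain f where f: "f \<in> carrier F" and u_eq: "u = ?N +>\<^bsub>F\<^esub> f" using u by (auto simp: q)
  have "P (?N +>\<^bsub>F\<^esub> f)"
    using A.R.is_cring f
  proof (induction f rule: free_module_induct)
    case zero
    have "t \<zero>\<^bsub>A\<^esub> \<zero>\<^bsub>B\<^esub> = \<zero>\<^bsub>T\<^esub>"
      using linear_map_zero[OF A.module_axioms module_tensor_product
          bilinear_map_linear(1)[OF bilinear_pure_tensor]] by simp
    then show ?case using pure[of "\<zero>\<^bsub>A\<^esub>" "\<zero>\<^bsub>B\<^esub>"] by (simp add: q)
  next
    case (add c i g)
    then obtain x a where i: "i = (x, a)" and xa: "x \<in> carrier A" "a \<in> carrier B" by auto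
    have "?N +>\<^bsub>F\<^esub> (c \<odot>\<^bsub>F\<^esub> e x a \<oplus>\<^bsub>F\<^esub> g) = (?N +>\<^bsub>F\<^esub> (c \<odot>\<^bsub>F\<^esub> e x a)) \<oplus>\<^bsub>T\<^esub> (?N +>\<^bsub>F\<^esub> g)"
      using add.hyps xa by (simp add: q e_closed)
    moreover have "?N +>\<^bsub>F\<^esub> g \<in> carrier T" using add.hyps by (simp add: q)
    ultimately show ?case
      using assms(3) scaled[OF add.hyps(1) xa] add.IH by (simp add: i)
  qed
  then show ?thesis by (simp add: u_eq)
qed

lemma linear_map_tensor_eqI:
  assumes h: "linear_map K T W h" and h': "linear_map K T W h'"
    and eq: "\<And>x a. x \<in> carrier A \<Longrightarrow> a \<in> carrier B \<Longrightarrow> h (t x a) = h' (t x a)"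
    and "u \<in> carrier T"
  shows "h u = h' u"
  using assms(4) by (induction u rule: tensor_induct) (use eq linear_mapD[OF h] linear_mapD[OF h'] in auto)

lemma bilinear_map_tensor_eqI:
  assumes f: "bilinear_map K T T W f" and g: "bilinear_map K T T W g"
    and eq: "\<And>x a y b. \<lbrakk>x \<in> carrier A; a \<in> carrier B; y \<in> carrier A; b \<in> carrier B\<rbrakk> \<Longrightarrow>
      f (t x a) (t y b) = g (t x a) (t y b)"
    and u: "u \<in> carrier T" and v: "v \<in> carrier T"
  shows "f u v = g u v"
proof (rule linear_map_tensor_eqI[OF bilinear_map_linear(1)[OF f v] bilinear_map_linear(1)[OF g v] _ u])
  fix x a assume xa: "x \<in> carrier A" "a \<in> carrier B"
  then have "t x a \<in> carrier T" by (rule pure_tensor_closed)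
  then show "f (t x a) v = g (t x a) v"
    using linear_map_tensor_eqI[OF bilinear_map_linear(2)[OF f] bilinear_map_linear(2)[OF g] _ v]
      eq xa by blast
qed

text \<open>
  This reduces an identity between nested products of three tensors to pure tensors.
\<close>

lemma trilinear_map_tensor_eqI:
  assumes f: "\<And>w. w \<in> carrier T \<Longrightarrow> bilinear_map K T T W (\<lambda>u v. f u v w)"
      "\<And>u v. u \<in> carrier T \<Longrightarrow> v \<in> carrier T \<Longrightarrow> linear_map K T W (f u v)"
    and g: "\<And>w. w \<in> carrier T \<Longrightarrow> bilinear_map K T T W (\<lambda>u v. g u v w)"
      "\<And>u v. u \<in> carrier T \<Longrightarrow> v \<in> carrier T \<Longrightarrow> linear_map K T W (g u v)"
    and eq: "\<And>x a y b z c. \<lbrakk>x \<in> carrier A; a \<in> carrier B; y \<in> carrier A; b \<in> carrier B;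
      z \<in> carrier A; c \<in> carrier B\<rbrakk> \<Longrightarrow> f (t x a) (t y b) (t z c) = g (t x a) (t y b) (t z c)"
    and u: "u \<in> carrier T" and v: "v \<in> carrier T" and w: "w \<in> carrier T"
  shows "f u v w = g u v w"
proof (rule bilinear_map_tensor_eqI[OF f(1)[OF w] g(1)[OF w] _ u v])
  fix x a y b assume xy: "x \<in> carrier A" "a \<in> carrier B" "y \<in> carrier A" "b \<in> carrier B"
  then have p: "t x a \<in> carrier T" "t y b \<in> carrier T" by (simp_all add: pure_tensor_closed)
  show "f (t x a) (t y b) w = g (t x a) (t y b) w"
    by (rule linear_map_tensor_eqI[OF f(2)[OF p] g(2)[OF p] _ w]) (rule eq[OF xy])
qed

text \<open>
  The linear extension of \<open>f\<close> to the free module annihilates the four families of relations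
  exactly because \<open>f\<close> is bilinear, so it factors through the quotient.
\<close>

lemma tensor_universal_property:
  assumes W: "module K W" and f: "bilinear_map K A B W f"
  shows "\<exists>h. linear_map K T W h \<and> (\<forall>x\<in>carrier A. \<forall>a\<in>carrier B. h (t x a) = f x a)"
proof -
  interpret W: module K W by fact
  let ?h = "free_lift K W (\<lambda>(x, a). f x a)"
  have h: "linear_map K F W ?h"
    by (rule linear_map_free_lift[OF W]) (auto intro: bilinear_map_closed[OF f])
  have gen: "?h (e x a) = f x a" if "x \<in> carrier A" "a \<in> carrier B" for x a
    using free_lift_gen[OF W, of "\<lambda>(x, a). f x a" "(x, a)"] bilinear_map_closed[OF f] that by simp
  note hD = linear_mapD(2,3)[OF h] linear_map_minus[OF F.module_axioms W h]
  have "tensor_relations K A B \<subseteq> {v \<in> carrier F. ?h v = \<zero>\<^bsub>W\<^esub>}"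
    using tensor_relations_subset
    unfolding tensor_relations_def Let_def
    by (auto simp: hD gen e_closed bilinear_map_add[OF f] bilinear_map_smult[OF f]
        bilinear_map_closed[OF f] W.M.minus_eq W.M.r_neg)
  then have "tensor_kernel K A B \<subseteq> {v \<in> carrier F. ?h v = \<zero>\<^bsub>W\<^esub>}"
    unfolding tensor_kernel_def
    by (rule submodule_generated_least[OF submodule_zero_set[OF F.module_axioms W h]])
  then have "?h n = \<zero>\<^bsub>W\<^esub>" if "n \<in> tensor_kernel K A B" for n
    using that by auto
  then obtain h' where h': "linear_map K T W h'"
    and h'_coset: "\<And>v. v \<in> carrier F \<Longrightarrow> h' (tensor_kernel K A B +>\<^bsub>F\<^esub> v) = ?h v"
    using F.quotient_module_lift[OF submodule_tensor_kernel W h] unfolding tensor_product_def by blast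
  show ?thesis
    by (rule exI[of _ h']) (simp add: h' pure_tensor_def h'_coset e_closed gen)
qed

text \<open>
  The universal property is used once for each argument. For fixed \<open>y\<close> and \<open>b\<close> it extends
  \<open>\<lambda>x a. g x a y b\<close> to a linear map \<open>L y b\<close> on the tensor product. For a fixed tensor \<open>u\<close> the
  value \<open>L y b u\<close> is bilinear in \<open>y\<close> and \<open>b\<close>, and it extends to the linear map \<open>m u\<close>.
  Both the bilinearity of \<open>L y b u\<close> and the linearity of \<open>m u v\<close> in \<open>u\<close> hold because
  linear maps that agree on pure tensors are equal.
\<close>

lemma tensor_bilinear_extension:
  assumes W: "module K W"
    and left: "\<And>y b. y \<in> carrier A \<Longrightarrow> b \<in> carrier B \<Longrightarrow> bilinear_map K A B W (\<lambda>x a. g x a y b)"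
    and right: "\<And>x a. x \<in> carrier A \<Longrightarrow> a \<in> carrier B \<Longrightarrow> bilinear_map K A B W (g x a)"
  shows "\<exists>m. bilinear_map K T T W m \<and>
    (\<forall>x\<in>carrier A. \<forall>y\<in>carrier A. \<forall>a\<in>carrier B. \<forall>b\<in>carrier B. m (t x a) (t y b) = g x a y b)"
proof -
  interpret W: module K W by fact
  define L where "L y b = (SOME h. linear_map K T W h \<and>
      (\<forall>x\<in>carrier A. \<forall>a\<in>carrier B. h (t x a) = g x a y b))" for y b
  have L_spec: "linear_map K T W (L y b) \<and>
      (\<forall>x\<in>carrier A. \<forall>a\<in>carrier B. L y b (t x a) = g x a y b)"
    if yb: "y \<in> carrier A" "b \<in> carrier B" for y b
    unfolding L_def by (rule someI_ex[OF tensor_universal_property[OF W left[OF yb]]])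
  then have L: "linear_map K T W (L y b)" if "y \<in> carrier A" "b \<in> carrier B" for y b
    using that by blast
  have L_pure: "L y b (t x a) = g x a y b"
    if "x \<in> carrier A" "a \<in> carrier B" "y \<in> carrier A" "b \<in> carrier B" for x a y b
    using L_spec that by blast
  have bil: "bilinear_map K A B W (\<lambda>y b. L y b u)" if u: "u \<in> carrier T" for u
    unfolding bilinear_map_def
  proof (intro conjI ballI)
    fix y b assume yb: "y \<in> carrier A" "b \<in> carrier B"
    show "L y b u \<in> carrier W" using linear_mapD(1)[OF L[OF yb] u] .
    fix c assume c: "c \<in> carrier K"
    show "L (c \<odot>\<^bsub>A\<^esub> y) b u = c \<odot>\<^bsub>W\<^esub> L y b u"
      by (rule linear_map_tensor_eqI[of W "L (c \<odot>\<^bsub>A\<^esub> y) b" "\<lambda>u. c \<odot>\<^bsub>W\<^esub> L y b u"])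
        (use yb c u in \<open>simp_all add: L L_pure linear_map_smult_map[OF W] bilinear_map_smult[OF right]\<close>)
    show "L y (c \<odot>\<^bsub>B\<^esub> b) u = c \<odot>\<^bsub>W\<^esub> L y b u"
      by (rule linear_map_tensor_eqI[of W "L y (c \<odot>\<^bsub>B\<^esub> b)" "\<lambda>u. c \<odot>\<^bsub>W\<^esub> L y b u"])
        (use yb c u in \<open>simp_all add: L L_pure linear_map_smult_map[OF W] bilinear_map_smult[OF right]\<close>)
  next
    fix y y' b assume yb: "y \<in> carrier A" "y' \<in> carrier A" "b \<in> carrier B"
    show "L (y \<oplus>\<^bsub>A\<^esub> y') b u = L y b u \<oplus>\<^bsub>W\<^esub> L y' b u"
      by (rule linear_map_tensor_eqI[of W "L (y \<oplus>\<^bsub>A\<^esub> y') b" "\<lambda>u. L y b u \<oplus>\<^bsub>W\<^esub> L y' b u"])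
        (use yb u in \<open>simp_all add: L L_pure linear_map_add_maps[OF W] bilinear_map_add[OF right]\<close>)
  next
    fix y b b' assume yb: "y \<in> carrier A" "b \<in> carrier B" "b' \<in> carrier B"
    show "L y (b \<oplus>\<^bsub>B\<^esub> b') u = L y b u \<oplus>\<^bsub>W\<^esub> L y b' u"
      by (rule linear_map_tensor_eqI[of W "L y (b \<oplus>\<^bsub>B\<^esub> b')" "\<lambda>u. L y b u \<oplus>\<^bsub>W\<^esub> L y b' u"])
        (use yb u in \<open>simp_all add: L L_pure linear_map_add_maps[OF W] bilinear_map_add[OF right]\<close>)
  qed
  define m where "m u = (SOME h. linear_map K T W h \<and>
      (\<forall>y\<in>carrier A. \<forall>b\<in>carrier B. h (t y b) = L y b u))" for u
  have m_spec: "linear_map K T W (m u) \<and>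
      (\<forall>y\<in>carrier A. \<forall>b\<in>carrier B. m u (t y b) = L y b u)"
    if u: "u \<in> carrier T" for u
    unfolding m_def by (rule someI_ex[OF tensor_universal_property[OF W bil[OF u]]])
  then have m: "linear_map K T W (m u)" if "u \<in> carrier T" for u
    using that by blast
  have m_pure: "m u (t y b) = L y b u"
    if "u \<in> carrier T" "y \<in> carrier A" "b \<in> carrier B" for u y b
    using m_spec that by blast
  have "linear_map K T W (\<lambda>u. m u v)" if v: "v \<in> carrier T" for v
    unfolding linear_map_def
  proof (intro conjI ballI)
    fix u assume u: "u \<in> carrier T"
    show "m u v \<in> carrier W" using linear_mapD(1)[OF m[OF u] v] .
    show "m (u \<oplus>\<^bsub>T\<^esub> u') v = m u v \<oplus>\<^bsub>W\<^esub> m u' v" if u': "u' \<in> carrier T" for u'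
      by (rule linear_map_tensor_eqI[of W "m (u \<oplus>\<^bsub>T\<^esub> u')" "\<lambda>v. m u v \<oplus>\<^bsub>W\<^esub> m u' v"])
        (use u u' v in \<open>simp_all add: m m_pure linear_map_add_maps[OF W] linear_mapD[OF L]\<close>)
  next
    fix c u assume c: "c \<in> carrier K" and u: "u \<in> carrier T"
    show "m (c \<odot>\<^bsub>T\<^esub> u) v = c \<odot>\<^bsub>W\<^esub> m u v"
      by (rule linear_map_tensor_eqI[of W "m (c \<odot>\<^bsub>T\<^esub> u)" "\<lambda>v. c \<odot>\<^bsub>W\<^esub> m u v"])
        (use c u v in \<open>simp_all add: m m_pure linear_map_smult_map[OF W] linear_mapD[OF L]\<close>)
  qed
  then have "bilinear_map K T T W m" using m by (intro bilinear_mapI)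
  moreover have "m (t x a) (t y b) = g x a y b"
    if "x \<in> carrier A" "a \<in> carrier B" "y \<in> carrier A" "b \<in> carrier B" for x a y b
    using that by (simp add: m_pure L_pure pure_tensor_closed)
  ultimately show ?thesis by blast
qed

end

section \<open>Cancellation in abelian groups\<close>

text \<open>
  These rules bring every signed sum into the form \<open>p \<ominus> n\<close>, with \<open>p\<close> and \<open>n\<close> free of signs. An
  equation between signed sums thus becomes an equation between plain sums, and reordering by
  associativity and commutativity decides whether all terms cancel.
\<close>

context abelian_group
begin

lemma diff_add_diff:
  assumes "a \<in> carrier G" "b \<in> carrier G" "c \<in> carrier G" "d \<in> carrier G"
  shows "(a \<ominus> b) \<oplus> (c \<ominus> d) = (a \<oplus> c) \<ominus> (b \<oplus> d)"
  using assms by (simp add: minus_eq minus_add a_ac)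

lemma diff_diff_diff:
  assumes "a \<in> carrier G" "b \<in> carrier G" "c \<in> carrier G" "d \<in> carrier G"
  shows "(a \<ominus> b) \<ominus> (c \<ominus> d) = (a \<oplus> d) \<ominus> (b \<oplus> c)"
  using assms by (simp add: minus_eq minus_add a_ac)

lemma diff_diff:
  assumes "a \<in> carrier G" "b \<in> carrier G" "c \<in> carrier G"
  shows "(a \<ominus> b) \<ominus> c = a \<ominus> (b \<oplus> c)" and "c \<ominus> (a \<ominus> b) = (c \<oplus> b) \<ominus> a"
  using assms by (simp_all add: minus_eq minus_add a_ac)

lemma diff_add:
  assumes "a \<in> carrier G" "b \<in> carrier G" "c \<in> carrier G"
  shows "(a \<ominus> b) \<oplus> c = (a \<oplus> c) \<ominus> b" and "c \<oplus> (a \<ominus> b) = (c \<oplus> a) \<ominus> b"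
  using assms by (simp_all add: minus_eq minus_add a_ac)

lemma diff_eq_zero_iff:
  assumes "a \<in> carrier G" "b \<in> carrier G"
  shows "a \<ominus> b = \<zero> \<longleftrightarrow> a = b"
  using assms by (metis add.inv_solve_right l_zero minus_eq zero_closed)

lemma diff_eq_diff_iff:
  assumes "a \<in> carrier G" "b \<in> carrier G" "c \<in> carrier G" "d \<in> carrier G"
  shows "a \<ominus> b = c \<ominus> d \<longleftrightarrow> a \<oplus> d = c \<oplus> b"
proof -
  have "a \<ominus> b = c \<ominus> d \<longleftrightarrow> (a \<ominus> b) \<ominus> (c \<ominus> d) = \<zero>"
    using assms by (simp add: diff_eq_zero_iff)
  also have "\<dots> \<longleftrightarrow> a \<oplus> d = b \<oplus> c"
    using assms by (simp add: diff_diff_diff diff_eq_zero_iff)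
  finally show ?thesis using assms by (simp add: a_comm)
qed

lemma add_pow_two: "a \<in> carrier G \<Longrightarrow> [(2::nat)] \<cdot> a = a \<oplus> a"
  by (simp add: numeral_2_eq_2)

lemmas diff_normalize = diff_add_diff diff_diff_diff diff_diff diff_add
  diff_eq_zero_iff diff_eq_diff_iff

end

section \<open>Products of three elements in a Novikov algebra\<close>

text \<open>
  Left symmetry says that the associator \<open>s\<close> of \<open>x\<close>, \<open>y\<close>, \<open>z\<close> does not change when \<open>x\<close> and \<open>y\<close>
  are interchanged. Naming it expresses both right-nested products through left-nested ones
  with the same correction term.
\<close>

lemma (in novikov_algebra) associators:
  assumes "x \<in> carrier A" "y \<in> carrier A" "z \<in> carrier A"
  obtains s where "s \<in> carrier A"
    and "x \<circ>\<^sub>N (y \<circ>\<^sub>N z) = (x \<circ>\<^sub>N y) \<circ>\<^sub>N z \<ominus>\<^bsub>A\<^esub> s"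
    and "y \<circ>\<^sub>N (x \<circ>\<^sub>N z) = (y \<circ>\<^sub>N x) \<circ>\<^sub>N z \<ominus>\<^bsub>A\<^esub> s"
proof
  note c = bilinear_map_closed[OF bilinear]
  have *: "p = q \<ominus>\<^bsub>A\<^esub> (q \<ominus>\<^bsub>A\<^esub> p)" if "p \<in> carrier A" "q \<in> carrier A" for p q
    using that by (simp add: A.M.minus_eq A.M.minus_add A.M.r_neg2)
  show "(x \<circ>\<^sub>N y) \<circ>\<^sub>N z \<ominus>\<^bsub>A\<^esub> x \<circ>\<^sub>N (y \<circ>\<^sub>N z) \<in> carrier A"
    using assms by (simp add: c)
  show "x \<circ>\<^sub>N (y \<circ>\<^sub>N z) = (x \<circ>\<^sub>N y) \<circ>\<^sub>N z \<ominus>\<^bsub>A\<^esub> ((x \<circ>\<^sub>N y) \<circ>\<^sub>N z \<ominus>\<^bsub>A\<^esub> x \<circ>\<^sub>N (y \<circ>\<^sub>N z))"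
    using assms by (intro *) (simp_all add: c)
  show "y \<circ>\<^sub>N (x \<circ>\<^sub>N z) = (y \<circ>\<^sub>N x) \<circ>\<^sub>N z \<ominus>\<^bsub>A\<^esub> ((x \<circ>\<^sub>N y) \<circ>\<^sub>N z \<ominus>\<^bsub>A\<^esub> x \<circ>\<^sub>N (y \<circ>\<^sub>N z))"
    unfolding left_symmetric[OF assms] using assms by (intro *) (simp_all add: c)
qed

section \<open>The transposed Poisson structure on the tensor product\<close>

locale novikov_poisson_pair = module_pair K A B +
  A: transposed_novikov_poisson_algebra K A dot1 circ +
  B: right_differential_novikov_poisson_algebra K B dot2 diamond
  for K (structure) and A and B and dot1 (infixl \<open>\<cdot>\<^sub>1\<close> 70) and circ (infixl \<open>\<circ>\<^sub>1\<close> 70)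
    and dot2 (infixl \<open>\<cdot>\<^sub>2\<close> 70) and diamond (infixl \<open>\<diamondop>\<^sub>2\<close> 70)
begin

lemma bilinear_diamond: "bilinear_map K B B B diamond"
  using B.diamond.bilinear by (simp add: bilinear_map_def)

lemmas closed = pure_tensor_closed bilinear_map_closed[OF A.dot.bilinear]
  bilinear_map_closed[OF A.circ.bilinear] bilinear_map_closed[OF B.dot.bilinear]
  bilinear_map_closed[OF bilinear_diamond]

lemma bilinear_pure_products:
  assumes f: "bilinear_map K A A A f" and g: "bilinear_map K B B B g"
    and y: "y \<in> carrier A" "b \<in> carrier B"
  shows "bilinear_map K A B T (\<lambda>x a. t (f x y) (g a b))"
    and "bilinear_map K A B T (\<lambda>x a. t (f y x) (g b a))"
  by (rule bilinear_map_comp[OF bilinear_pure_tensor bilinear_map_linear(1)[OF f y(1)]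
        bilinear_map_linear(1)[OF g y(2)]],
      rule bilinear_map_comp[OF bilinear_pure_tensor bilinear_map_linear(2)[OF f y(1)]
        bilinear_map_linear(2)[OF g y(2)]])

lemma ex_tensor_dot: "\<exists>dot. is_tensor_dot K A B dot1 dot2 dot"
  unfolding is_tensor_dot_def Let_def
  by (rule tensor_bilinear_extension[OF module_tensor_product,
        where g = "\<lambda>x a y b. t (x \<cdot>\<^sub>1 y) (a \<cdot>\<^sub>2 b)"])
    (rule bilinear_pure_products[OF A.dot.bilinear B.dot.bilinear]; assumption)+

lemma ex_tensor_bracket: "\<exists>bracket. is_tensor_bracket K A B circ diamond bracket"
  unfolding is_tensor_bracket_def Let_def
  by (rule tensor_bilinear_extension[OF module_tensor_product,
        where g = "\<lambda>x a y b. t (x \<circ>\<^sub>1 y) (a \<diamondop>\<^sub>2 b) \<ominus>\<^bsub>T\<^esub> t (y \<circ>\<^sub>1 x) (b \<diamondop>\<^sub>2 a)"];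
      rule bilinear_map_diff[OF module_tensor_product];
      rule bilinear_pure_products[OF A.circ.bilinear bilinear_diamond]; assumption)

end

text \<open>
  The two operations are arbitrary ones that meet the specification: outside the carrier they
  are not determined, and the axioms have to hold for every choice.
\<close>

locale tensor_operations = novikov_poisson_pair +
  fixes dot (infixl \<open>\<cdot>\<close> 70) and bracket (\<open>\<lbrakk>_,/ _\<rbrakk>\<close>)
  assumes is_dot: "is_tensor_dot K A B dot1 dot2 dot"
    and is_bracket: "is_tensor_bracket K A B circ diamond bracket"
begin

lemma dot_bilinear: "bilinear_map K T T T dot"
  and dot_pure: "\<lbrakk>x \<in> carrier A; a \<in> carrier B; y \<in> carrier A; b \<in> carrier B\<rbrakk> \<Longrightarrow>
    t x a \<cdot> t y b = t (x \<cdot>\<^sub>1 y) (a \<cdot>\<^sub>2 b)"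
  using is_dot by (simp_all add: is_tensor_dot_def Let_def)

lemma bracket_bilinear: "bilinear_map K T T T bracket"
  and bracket_pure: "\<lbrakk>x \<in> carrier A; a \<in> carrier B; y \<in> carrier A; b \<in> carrier B\<rbrakk> \<Longrightarrow>
    \<lbrakk>t x a, t y b\<rbrakk> = t (x \<circ>\<^sub>1 y) (a \<diamondop>\<^sub>2 b) \<ominus>\<^bsub>T\<^esub> t (y \<circ>\<^sub>1 x) (b \<diamondop>\<^sub>2 a)"
  using is_bracket by (simp_all add: is_tensor_bracket_def Let_def)

lemmas dot_closed = bilinear_map_closed[OF dot_bilinear]
lemmas bracket_closed = bilinear_map_closed[OF bracket_bilinear]

lemmas pure_add = bilinear_map_add[OF bilinear_pure_tensor]
lemmas pure_minus =
  bilinear_map_minus[OF A.module_axioms B.module_axioms module_tensor_product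
    bilinear_pure_tensor]
lemmas T_minus =
  bilinear_map_minus[OF module_tensor_product module_tensor_product module_tensor_product]

lemmas linear_map_dot =
  linear_map_comp[OF _ bilinear_map_linear(1)[OF dot_bilinear]]
  linear_map_comp[OF _ bilinear_map_linear(2)[OF dot_bilinear]]
lemmas linear_map_bracket =
  linear_map_comp[OF _ bilinear_map_linear(1)[OF bracket_bilinear]]
  linear_map_comp[OF _ bilinear_map_linear(2)[OF bracket_bilinear]]

lemmas linear_map_intros = linear_map_dot linear_map_bracket
  linear_map_add_maps[OF module_tensor_product] linear_map_zero_map[OF module_tensor_product]
  linear_map_ident

lemma dot_commutative:
  assumes "u \<in> carrier T" and "v \<in> carrier T"
  shows "u \<cdot> v = v \<cdot> u"
proof (rule bilinear_map_tensor_eqI[where W = T and f = "\<lambda>u v. u \<cdot> v" and g = "\<lambda>u v. v \<cdot> u"])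
  fix x a y b
  assume "x \<in> carrier A" "a \<in> carrier B" "y \<in> carrier A" "b \<in> carrier B"
  then show "t x a \<cdot> t y b = t y b \<cdot> t x a"
    by (simp add: dot_pure A.dot.commutative B.dot.commutative)
qed ((intro bilinear_mapI linear_map_intros)?; simp add: assms)+

lemma dot_associative:
  assumes "u \<in> carrier T" and "v \<in> carrier T" and "w \<in> carrier T"
  shows "(u \<cdot> v) \<cdot> w = u \<cdot> (v \<cdot> w)"
proof (rule trilinear_map_tensor_eqI[where W = T and f = "\<lambda>u v w. (u \<cdot> v) \<cdot> w"
      and g = "\<lambda>u v w. u \<cdot> (v \<cdot> w)"])
  fix x a y b z c
  assume "x \<in> carrier A" "a \<in> carrier B" "y \<in> carrier A" "b \<in> carrier B" "z \<in> carrier A" "c \<in> carrier B"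
  then show "(t x a \<cdot> t y b) \<cdot> t z c = t x a \<cdot> (t y b \<cdot> t z c)"
    by (simp add: dot_pure closed A.dot.associative B.dot.associative)
qed ((intro bilinear_mapI linear_map_intros)?; simp add: assms dot_closed)+

lemma bracket_skew:
  assumes "u \<in> carrier T" and "v \<in> carrier T"
  shows "\<lbrakk>u, v\<rbrakk> \<oplus>\<^bsub>T\<^esub> \<lbrakk>v, u\<rbrakk> = \<zero>\<^bsub>T\<^esub>"
proof (rule bilinear_map_tensor_eqI[where W = T and f = "\<lambda>u v. \<lbrakk>u, v\<rbrakk> \<oplus>\<^bsub>T\<^esub> \<lbrakk>v, u\<rbrakk>"
      and g = "\<lambda>u v. \<zero>\<^bsub>T\<^esub>"])
  fix x a y b
  assume "x \<in> carrier A" "a \<in> carrier B" "y \<in> carrier A" "b \<in> carrier B"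
  then show "\<lbrakk>t x a, t y b\<rbrakk> \<oplus>\<^bsub>T\<^esub> \<lbrakk>t y b, t x a\<rbrakk> = \<zero>\<^bsub>T\<^esub>"
    by (simp add: bracket_pure closed T.M.diff_normalize T.M.a_comm)
qed ((intro bilinear_mapI linear_map_intros)?; simp add: assms)+

text \<open>
  The bracket of a tensor with itself is not linear in that tensor. For a sum of two tensors the
  mixed terms cancel by antisymmetry, which is bilinear and so may be checked on pure tensors.
\<close>

lemma bracket_alternating:
  assumes "u \<in> carrier T"
  shows "\<lbrakk>u, u\<rbrakk> = \<zero>\<^bsub>T\<^esub>"
  using assms
proof (induction u rule: tensor_induct)
  case (pure x a)
  then show ?case by (simp add: bracket_pure closed T.M.diff_eq_zero_iff)
next
  case (add u v)
  then show ?case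
    by (simp add: bilinear_map_add[OF bracket_bilinear] bracket_closed bracket_skew)
qed

text \<open>
  In \<open>A\<close> a left-nested product of \<open>x\<close>, \<open>y\<close>, \<open>z\<close> in any order depends only on its first
  letter: call it \<open>X\<close>, \<open>Y\<close> or \<open>Z\<close>. A right-nested product is the left-nested one with the
  same first letter minus an associator \<open>sx\<close>, \<open>sy\<close> or \<open>sz\<close> that depends only on the last letter.
  In \<open>B\<close> all is mirrored: a right-nested product \<open>a'\<close>, \<open>b'\<close> or \<open>c'\<close> depends only on its last
  letter, and a left-nested one is \<open>a'\<close>, \<open>b'\<close> or \<open>c'\<close> minus \<open>ra\<close>, \<open>rb\<close> or \<open>rc\<close>, which depends
  only on the first letter. In these terms the bracket of \<open>x \<otimes> a\<close> with that of \<open>y \<otimes> b\<close> and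
  \<open>z \<otimes> c\<close> is
  \<open>X \<otimes> c' - sz \<otimes> c' - Y \<otimes> a' + Y \<otimes> rb - X \<otimes> b' + sy \<otimes> b' + Z \<otimes> a' - Z \<otimes> rc\<close>.
  Each of the twelve tensors that occur in the cyclic sum occurs there once with either sign.
\<close>

lemma jacobi_pure:
  assumes x: "x \<in> carrier A" "y \<in> carrier A" "z \<in> carrier A"
    and a: "a \<in> carrier B" "b \<in> carrier B" "c \<in> carrier B"
  shows "\<lbrakk>t x a, \<lbrakk>t y b, t z c\<rbrakk>\<rbrakk> \<oplus>\<^bsub>T\<^esub> \<lbrakk>t y b, \<lbrakk>t z c, t x a\<rbrakk>\<rbrakk> \<oplus>\<^bsub>T\<^esub> \<lbrakk>t z c, \<lbrakk>t x a, t y b\<rbrakk>\<rbrakk> = \<zero>\<^bsub>T\<^esub>"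
proof -
  obtain sx where sx: "sx \<in> carrier A" "y \<circ>\<^sub>1 (z \<circ>\<^sub>1 x) = (y \<circ>\<^sub>1 z) \<circ>\<^sub>1 x \<ominus>\<^bsub>A\<^esub> sx"
      "z \<circ>\<^sub>1 (y \<circ>\<^sub>1 x) = (z \<circ>\<^sub>1 y) \<circ>\<^sub>1 x \<ominus>\<^bsub>A\<^esub> sx"
    using A.circ.associators x by metis
  obtain sy where sy: "sy \<in> carrier A" "x \<circ>\<^sub>1 (z \<circ>\<^sub>1 y) = (x \<circ>\<^sub>1 z) \<circ>\<^sub>1 y \<ominus>\<^bsub>A\<^esub> sy"
      "z \<circ>\<^sub>1 (x \<circ>\<^sub>1 y) = (z \<circ>\<^sub>1 x) \<circ>\<^sub>1 y \<ominus>\<^bsub>A\<^esub> sy"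
    using A.circ.associators x by metis
  obtain sz where sz: "sz \<in> carrier A" "x \<circ>\<^sub>1 (y \<circ>\<^sub>1 z) = (x \<circ>\<^sub>1 y) \<circ>\<^sub>1 z \<ominus>\<^bsub>A\<^esub> sz"
      "y \<circ>\<^sub>1 (x \<circ>\<^sub>1 z) = (y \<circ>\<^sub>1 x) \<circ>\<^sub>1 z \<ominus>\<^bsub>A\<^esub> sz"
    using A.circ.associators x by metis
  obtain ra where ra: "ra \<in> carrier B" "(a \<diamondop>\<^sub>2 b) \<diamondop>\<^sub>2 c = a \<diamondop>\<^sub>2 (b \<diamondop>\<^sub>2 c) \<ominus>\<^bsub>B\<^esub> ra"
      "(a \<diamondop>\<^sub>2 c) \<diamondop>\<^sub>2 b = a \<diamondop>\<^sub>2 (c \<diamondop>\<^sub>2 b) \<ominus>\<^bsub>B\<^esub> ra"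
    using B.diamond.associators a by metis
  obtain rb where rb: "rb \<in> carrier B" "(b \<diamondop>\<^sub>2 a) \<diamondop>\<^sub>2 c = b \<diamondop>\<^sub>2 (a \<diamondop>\<^sub>2 c) \<ominus>\<^bsub>B\<^esub> rb"
      "(b \<diamondop>\<^sub>2 c) \<diamondop>\<^sub>2 a = b \<diamondop>\<^sub>2 (c \<diamondop>\<^sub>2 a) \<ominus>\<^bsub>B\<^esub> rb"
    using B.diamond.associators a by metis
  obtain rc where rc: "rc \<in> carrier B" "(c \<diamondop>\<^sub>2 a) \<diamondop>\<^sub>2 b = c \<diamondop>\<^sub>2 (a \<diamondop>\<^sub>2 b) \<ominus>\<^bsub>B\<^esub> rc"
      "(c \<diamondop>\<^sub>2 b) \<diamondop>\<^sub>2 a = c \<diamondop>\<^sub>2 (b \<diamondop>\<^sub>2 a) \<ominus>\<^bsub>B\<^esub> rc"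
    using B.diamond.associators a by metis
  have A_comm: "(x \<circ>\<^sub>1 z) \<circ>\<^sub>1 y = (x \<circ>\<^sub>1 y) \<circ>\<^sub>1 z" "(y \<circ>\<^sub>1 z) \<circ>\<^sub>1 x = (y \<circ>\<^sub>1 x) \<circ>\<^sub>1 z"
    "(z \<circ>\<^sub>1 y) \<circ>\<^sub>1 x = (z \<circ>\<^sub>1 x) \<circ>\<^sub>1 y"
    using x by (simp_all add: A.circ.right_commutative)
  have B_comm: "c \<diamondop>\<^sub>2 (b \<diamondop>\<^sub>2 a) = b \<diamondop>\<^sub>2 (c \<diamondop>\<^sub>2 a)" "c \<diamondop>\<^sub>2 (a \<diamondop>\<^sub>2 b) = a \<diamondop>\<^sub>2 (c \<diamondop>\<^sub>2 b)"
    "b \<diamondop>\<^sub>2 (a \<diamondop>\<^sub>2 c) = a \<diamondop>\<^sub>2 (b \<diamondop>\<^sub>2 c)"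
    using a by (simp_all add: B.diamond.right_commutative)
  define X Y Z where XYZ: "X = (x \<circ>\<^sub>1 y) \<circ>\<^sub>1 z" "Y = (y \<circ>\<^sub>1 x) \<circ>\<^sub>1 z" "Z = (z \<circ>\<^sub>1 x) \<circ>\<^sub>1 y"
  define a' b' c' where abc: "a' = b \<diamondop>\<^sub>2 (c \<diamondop>\<^sub>2 a)" "b' = a \<diamondop>\<^sub>2 (c \<diamondop>\<^sub>2 b)" "c' = a \<diamondop>\<^sub>2 (b \<diamondop>\<^sub>2 c)"
  have XYZ_closed: "X \<in> carrier A" "Y \<in> carrier A" "Z \<in> carrier A"
    and abc_closed: "a' \<in> carrier B" "b' \<in> carrier B" "c' \<in> carrier B"
    using x a by (simp_all add: XYZ abc closed)
  note A_words = sx sy sz A_comm XYZ[symmetric]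
  note B_words = ra rb rc B_comm abc[symmetric]
  have nested: "\<lbrakk>t u p, \<lbrakk>t v q, t w r\<rbrakk>\<rbrakk> =
      (t (u \<circ>\<^sub>1 (v \<circ>\<^sub>1 w)) (p \<diamondop>\<^sub>2 (q \<diamondop>\<^sub>2 r)) \<ominus>\<^bsub>T\<^esub> t ((v \<circ>\<^sub>1 w) \<circ>\<^sub>1 u) ((q \<diamondop>\<^sub>2 r) \<diamondop>\<^sub>2 p)) \<ominus>\<^bsub>T\<^esub>
      (t (u \<circ>\<^sub>1 (w \<circ>\<^sub>1 v)) (p \<diamondop>\<^sub>2 (r \<diamondop>\<^sub>2 q)) \<ominus>\<^bsub>T\<^esub> t ((w \<circ>\<^sub>1 v) \<circ>\<^sub>1 u) ((r \<diamondop>\<^sub>2 q) \<diamondop>\<^sub>2 p))"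
    if "u \<in> carrier A" "v \<in> carrier A" "w \<in> carrier A" "p \<in> carrier B" "q \<in> carrier B" "r \<in> carrier B"
    for u v w p q r
    using that by (simp add: bracket_pure T_minus[OF bracket_bilinear] closed)
  have "\<lbrakk>t x a, \<lbrakk>t y b, t z c\<rbrakk>\<rbrakk> =
      (t (X \<ominus>\<^bsub>A\<^esub> sz) c' \<ominus>\<^bsub>T\<^esub> t Y (a' \<ominus>\<^bsub>B\<^esub> rb)) \<ominus>\<^bsub>T\<^esub>
      (t (X \<ominus>\<^bsub>A\<^esub> sy) b' \<ominus>\<^bsub>T\<^esub> t Z (a' \<ominus>\<^bsub>B\<^esub> rc))"
    using x a by (simp add: nested A_words B_words)
  moreover have "\<lbrakk>t y b, \<lbrakk>t z c, t x a\<rbrakk>\<rbrakk> =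
      (t (Y \<ominus>\<^bsub>A\<^esub> sx) a' \<ominus>\<^bsub>T\<^esub> t Z (b' \<ominus>\<^bsub>B\<^esub> rc)) \<ominus>\<^bsub>T\<^esub>
      (t (Y \<ominus>\<^bsub>A\<^esub> sz) c' \<ominus>\<^bsub>T\<^esub> t X (b' \<ominus>\<^bsub>B\<^esub> ra))"
    using x a by (simp add: nested A_words B_words)
  moreover have "\<lbrakk>t z c, \<lbrakk>t x a, t y b\<rbrakk>\<rbrakk> =
      (t (Z \<ominus>\<^bsub>A\<^esub> sy) b' \<ominus>\<^bsub>T\<^esub> t X (c' \<ominus>\<^bsub>B\<^esub> ra)) \<ominus>\<^bsub>T\<^esub>
      (t (Z \<ominus>\<^bsub>A\<^esub> sx) a' \<ominus>\<^bsub>T\<^esub> t Y (c' \<ominus>\<^bsub>B\<^esub> rb))"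
    using x a by (simp add: nested A_words B_words)
  ultimately show ?thesis
    using XYZ_closed abc_closed sx(1) sy(1) sz(1) ra(1) rb(1) rc(1)
    by (simp add: pure_minus pure_tensor_closed T.M.diff_normalize T.M.a_ac)
qed

lemma bracket_jacobi:
  assumes "u \<in> carrier T" and "v \<in> carrier T" and "w \<in> carrier T"
  shows "\<lbrakk>u, \<lbrakk>v, w\<rbrakk>\<rbrakk> \<oplus>\<^bsub>T\<^esub> \<lbrakk>v, \<lbrakk>w, u\<rbrakk>\<rbrakk> \<oplus>\<^bsub>T\<^esub> \<lbrakk>w, \<lbrakk>u, v\<rbrakk>\<rbrakk> = \<zero>\<^bsub>T\<^esub>"
  by (rule trilinear_map_tensor_eqI[where W = T and g = "\<lambda>u v w. \<zero>\<^bsub>T\<^esub>"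
        and f = "\<lambda>u v w. \<lbrakk>u, \<lbrakk>v, w\<rbrakk>\<rbrakk> \<oplus>\<^bsub>T\<^esub> \<lbrakk>v, \<lbrakk>w, u\<rbrakk>\<rbrakk> \<oplus>\<^bsub>T\<^esub> \<lbrakk>w, \<lbrakk>u, v\<rbrakk>\<rbrakk>"])
    ((intro bilinear_mapI linear_map_intros)?; simp add: assms bracket_closed jacobi_pure)+

text \<open>
  Put \<open>p = hx \<circ> y = hy \<circ> x\<close>, \<open>q = x \<circ> hy\<close> and \<open>r = y \<circ> hx\<close> in \<open>A\<close>; twice \<open>h(x \<circ> y)\<close> is \<open>p + q\<close>, and
  twice \<open>h(y \<circ> x)\<close> is \<open>p + r\<close>. In \<open>B\<close> put \<open>f = d(a \<diamondop> b)\<close>, \<open>g = d(b \<diamondop> a)\<close> and \<open>s = d \<diamondop> ab\<close>, which is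
  both \<open>(d \<diamondop> b)a\<close> and \<open>(d \<diamondop> a)b\<close>; then the Leibniz rule reads \<open>da \<diamondop> b = s + f\<close> and
  \<open>db \<diamondop> a = s + g\<close>. The right-hand side is \<open>p \<otimes> (s + f) - r \<otimes> g + q \<otimes> f - p \<otimes> (s + g)\<close>: the term
  \<open>p \<otimes> s\<close> cancels and \<open>(p + q) \<otimes> f - (p + r) \<otimes> g\<close> remains.
\<close>

lemma transposed_leibniz_pure:
  assumes x: "x \<in> carrier A" "y \<in> carrier A" "h \<in> carrier A"
    and a: "a \<in> carrier B" "b \<in> carrier B" "d \<in> carrier B"
  shows "t h d \<cdot> \<lbrakk>t x a, t y b\<rbrakk> \<oplus>\<^bsub>T\<^esub> t h d \<cdot> \<lbrakk>t x a, t y b\<rbrakk> =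
    \<lbrakk>t h d \<cdot> t x a, t y b\<rbrakk> \<oplus>\<^bsub>T\<^esub> \<lbrakk>t x a, t h d \<cdot> t y b\<rbrakk>"
proof -
  define p where "p = (h \<cdot>\<^sub>1 x) \<circ>\<^sub>1 y"
  define q where "q = x \<circ>\<^sub>1 (h \<cdot>\<^sub>1 y)"
  define r where "r = y \<circ>\<^sub>1 (h \<cdot>\<^sub>1 x)"
  define s where "s = d \<diamondop>\<^sub>2 (a \<cdot>\<^sub>2 b)"
  define f where "f = d \<cdot>\<^sub>2 (a \<diamondop>\<^sub>2 b)"
  define g where "g = d \<cdot>\<^sub>2 (b \<diamondop>\<^sub>2 a)"
  have mem: "p \<in> carrier A" "q \<in> carrier A" "r \<in> carrier A"
    "s \<in> carrier B" "f \<in> carrier B" "g \<in> carrier B"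
    using x a by (simp_all add: p_def q_def r_def s_def f_def g_def closed)
  have hxy: "(h \<cdot>\<^sub>1 y) \<circ>\<^sub>1 x = p"
    using x A.dot_circ_commute by (simp add: p_def)
  have twice: "h \<cdot>\<^sub>1 (x \<circ>\<^sub>1 y) \<oplus>\<^bsub>A\<^esub> h \<cdot>\<^sub>1 (x \<circ>\<^sub>1 y) = p \<oplus>\<^bsub>A\<^esub> q"
    "h \<cdot>\<^sub>1 (y \<circ>\<^sub>1 x) \<oplus>\<^bsub>A\<^esub> h \<cdot>\<^sub>1 (y \<circ>\<^sub>1 x) = p \<oplus>\<^bsub>A\<^esub> r"
    using A.transposed_leibniz[of x y h] A.transposed_leibniz[of y x h] x
    by (simp_all add: A.M.add_pow_two closed p_def q_def r_def hxy)
  have derivation: "(d \<cdot>\<^sub>2 a) \<diamondop>\<^sub>2 b = s \<oplus>\<^bsub>B\<^esub> f" "(d \<cdot>\<^sub>2 b) \<diamondop>\<^sub>2 a = s \<oplus>\<^bsub>B\<^esub> g"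
    using a by (simp_all add: B.leibniz B.diamond_dot s_def f_def g_def B.dot.commutative[of b a])
  have pull: "b \<diamondop>\<^sub>2 (d \<cdot>\<^sub>2 a) = g" "a \<diamondop>\<^sub>2 (d \<cdot>\<^sub>2 b) = f"
    using a by (simp_all add: g_def f_def B.diamond_dot[symmetric] B.dot.commutative closed)
  have tt: "t (h \<cdot>\<^sub>1 (x \<circ>\<^sub>1 y)) f \<oplus>\<^bsub>T\<^esub> t (h \<cdot>\<^sub>1 (x \<circ>\<^sub>1 y)) f = t (p \<oplus>\<^bsub>A\<^esub> q) f"
    "t (h \<cdot>\<^sub>1 (y \<circ>\<^sub>1 x)) g \<oplus>\<^bsub>T\<^esub> t (h \<cdot>\<^sub>1 (y \<circ>\<^sub>1 x)) g = t (p \<oplus>\<^bsub>A\<^esub> r) g"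
    using x mem by (simp_all add: pure_add(1)[symmetric] closed twice)
  have "t h d \<cdot> \<lbrakk>t x a, t y b\<rbrakk> \<oplus>\<^bsub>T\<^esub> t h d \<cdot> \<lbrakk>t x a, t y b\<rbrakk> =
      t (p \<oplus>\<^bsub>A\<^esub> q) f \<ominus>\<^bsub>T\<^esub> t (p \<oplus>\<^bsub>A\<^esub> r) g"
    using x a mem
    by (simp add: bracket_pure T_minus[OF dot_bilinear] dot_pure closed f_def[symmetric]
        g_def[symmetric] T.M.diff_add_diff tt)
  also have "\<dots> = (t p (s \<oplus>\<^bsub>B\<^esub> f) \<ominus>\<^bsub>T\<^esub> t r g) \<oplus>\<^bsub>T\<^esub> (t q f \<ominus>\<^bsub>T\<^esub> t p (s \<oplus>\<^bsub>B\<^esub> g))"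
    using mem by (simp add: pure_add pure_tensor_closed T.M.diff_normalize T.M.a_ac)
  also have "\<dots> = \<lbrakk>t h d \<cdot> t x a, t y b\<rbrakk> \<oplus>\<^bsub>T\<^esub> \<lbrakk>t x a, t h d \<cdot> t y b\<rbrakk>"
    using x a
    by (simp add: dot_pure bracket_pure closed derivation pull hxy p_def[symmetric]
        q_def[symmetric] r_def[symmetric])
  finally show ?thesis .
qed

lemma bracket_transposed_leibniz:
  assumes "u \<in> carrier T" and "v \<in> carrier T" and "w \<in> carrier T"
  shows "w \<cdot> \<lbrakk>u, v\<rbrakk> \<oplus>\<^bsub>T\<^esub> w \<cdot> \<lbrakk>u, v\<rbrakk> = \<lbrakk>w \<cdot> u, v\<rbrakk> \<oplus>\<^bsub>T\<^esub> \<lbrakk>u, w \<cdot> v\<rbrakk>"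
  by (rule trilinear_map_tensor_eqI[where W = T
        and f = "\<lambda>u v w. w \<cdot> \<lbrakk>u, v\<rbrakk> \<oplus>\<^bsub>T\<^esub> w \<cdot> \<lbrakk>u, v\<rbrakk>"
        and g = "\<lambda>u v w. \<lbrakk>w \<cdot> u, v\<rbrakk> \<oplus>\<^bsub>T\<^esub> \<lbrakk>u, w \<cdot> v\<rbrakk>"])
    ((intro bilinear_mapI linear_map_intros)?;
      simp add: assms dot_closed bracket_closed transposed_leibniz_pure)+

lemma transposed_poisson_algebra_tensor: "transposed_poisson_algebra K T dot bracket"
  by unfold_locales
    (rule dot_bilinear bracket_bilinear dot_commutative dot_associative bracket_alternating
       bracket_jacobi; assumption
     | simp add: T.M.add_pow_two dot_closed bracket_closed bracket_transposed_leibniz)+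

end

theorem proposition2p9:
  fixes K :: "('k, 'r) ring_scheme"
    and A :: "('k, 'a, 's) module_scheme"
    and B :: "('k, 'b, 't) module_scheme"
    and dot1 circ :: "'a \<Rightarrow> 'a \<Rightarrow> 'a"
    and dot2 diamond :: "'b \<Rightarrow> 'b \<Rightarrow> 'b"
  assumes "field K"
    and "\<one>\<^bsub>K\<^esub> \<oplus>\<^bsub>K\<^esub> \<one>\<^bsub>K\<^esub> \<noteq> \<zero>\<^bsub>K\<^esub>"
    and "transposed_novikov_poisson_algebra K A dot1 circ"
    and "right_differential_novikov_poisson_algebra K B dot2 diamond"
  shows "(\<exists>dot. is_tensor_dot K A B dot1 dot2 dot) \<and>
    (\<exists>bracket. is_tensor_bracket K A B circ diamond bracket) \<and>
    (\<forall>dot bracket.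
      is_tensor_dot K A B dot1 dot2 dot \<and> is_tensor_bracket K A B circ diamond bracket \<longrightarrow>
      transposed_poisson_algebra K (tensor_product K A B) dot bracket)"
proof -
  interpret A: transposed_novikov_poisson_algebra K A dot1 circ by fact
  interpret B: right_differential_novikov_poisson_algebra K B dot2 diamond by fact
  interpret novikov_poisson_pair K A B dot1 circ dot2 diamond by unfold_locales
  show ?thesis
    using ex_tensor_dot ex_tensor_bracket tensor_operations.transposed_poisson_algebra_tensor
      tensor_operations.intro[OF novikov_poisson_pair_axioms tensor_operations_axioms.intro] by blast
qed

end
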